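(* Let $\Gamma$ and $\Delta$ be finite simplicial graphs and let $n\ge 0$ be an integer. If the right-angled Artin groups $A_\Gamma$ and $A_\Delta$ are commensurable and $\Gamma$ has no separating $k$-cliques for any $0\le k\le n$, then $\Delta$ has no separating $k$-cliques for any $0\le k\le n$.
   Context: For a finite simplicial graph $\Gamma$, the right-angled Artin group $A_\Gamma$ is the group with one generator for each vertex of $\Gamma$ and with defining relations that two generators commute if and only if the corresponding vertices span an edge. A clique is a graph in which every pair of distinct vertices spans an edge; a $k$-clique is a clique with $k$ vertices (the $0$-clique is the empty graph). A (possibly empty) induced subgraph $\Delta$ of $\Gamma$ is separating if $\Gamma\setminus\Delta$ (the induced subgraph on the vertices not in $\Delta$) is disconnected, i.e. has at least two connected components; in particular cliques have no separating cliques. Two groups are (abstractly) commensurable if they contain isomorphic finite index subgroups. *)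

theory Defs
  imports "HOL-Algebra.Coset" "Graph_Theory.Graph_Theory"
begin

section \<open>Groups given by generators and relators\<close>

text \<open>The letter \<open>(x, True)\<close> stands for \<open>x\<close> and \<open>(x, False)\<close> for its formal inverse.\<close>

type_synonym 'a gword = "('a \<times> bool) list"

definition gwords :: "'a set \<Rightarrow> 'a gword set" where
  "gwords X = lists (X \<times> UNIV)"

text \<open>The congruence on words over \<open>X\<close> generated by free cancellation and by \<open>r \<sim> 1\<close> for
  every relator \<open>r \<in> R\<close>. Elements of \<open>R\<close> that are not words over \<open>X\<close> are ignored.\<close>

inductive_set pres_rel :: "'a set \<Rightarrow> 'a gword set \<Rightarrow> ('a gword \<times> 'a gword) set"
  for X :: "'a set" and R :: "'a gword set" where
  refl: "w \<in> gwords X \<Longrightarrow> (w, w) \<in> pres_rel X R"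
| sym: "(v, w) \<in> pres_rel X R \<Longrightarrow> (w, v) \<in> pres_rel X R"
| trans: "(u, v) \<in> pres_rel X R \<Longrightarrow> (v, w) \<in> pres_rel X R \<Longrightarrow> (u, w) \<in> pres_rel X R"
| cancel: "u \<in> gwords X \<Longrightarrow> v \<in> gwords X \<Longrightarrow> x \<in> X \<Longrightarrow>
    (u @ [(x, b), (x, \<not> b)] @ v, u @ v) \<in> pres_rel X R"
| relator: "u \<in> gwords X \<Longrightarrow> v \<in> gwords X \<Longrightarrow> r \<in> R \<Longrightarrow> r \<in> gwords X \<Longrightarrow>
    (u @ r @ v, u @ v) \<in> pres_rel X R"

definition presented_group :: "'a set \<Rightarrow> 'a gword set \<Rightarrow> 'a gword set monoid" where
  "presented_group X R =
    \<lparr>carrier = gwords X // pres_rel X R,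
     monoid.mult = (\<lambda>A B. \<Union>a\<in>A. \<Union>b\<in>B. pres_rel X R `` {a @ b}),
     one = pres_rel X R `` {[]}\<rparr>"

lemma gwords_simps [simp]:
  "[] \<in> gwords X"
  "u @ v \<in> gwords X \<longleftrightarrow> u \<in> gwords X \<and> v \<in> gwords X"
  "(x, b) # w \<in> gwords X \<longleftrightarrow> x \<in> X \<and> w \<in> gwords X"
  by (auto simp: gwords_def)

lemma pres_rel_in_gwords:
  "(v, w) \<in> pres_rel X R \<Longrightarrow> v \<in> gwords X \<and> w \<in> gwords X"
  by (induction rule: pres_rel.induct) auto

lemma equiv_pres_rel: "equiv (gwords X) (pres_rel X R)"
proof (rule equivI)
  show "pres_rel X R \<subseteq> gwords X \<times> gwords X"
    using pres_rel_in_gwords by fast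
  show "refl_on (gwords X) (pres_rel X R)"
    by (auto intro!: refl_onI pres_rel.refl)
  show "sym (pres_rel X R)"
    by (auto intro!: symI pres_rel.sym)
  show "trans (pres_rel X R)"
    by (blast intro: transI pres_rel.trans)
qed

lemma pres_rel_context:
  assumes "(v, w) \<in> pres_rel X R" "a \<in> gwords X" "b \<in> gwords X"
  shows "(a @ v @ b, a @ w @ b) \<in> pres_rel X R"
  using assms
proof (induction rule: pres_rel.induct)
  case (cancel u v x c)
  then show ?case using pres_rel.cancel[of "a @ u" X "v @ b" x c R] by simp
next
  case (relator u v r)
  then show ?case using pres_rel.relator[of "a @ u" X "v @ b" r R] by simp
qed (auto intro: pres_rel.intros)

lemma congruent2_append:
  "congruent2 (pres_rel X R) (pres_rel X R) (\<lambda>a b. pres_rel X R `` {a @ b})"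
proof (rule congruent2I[OF equiv_pres_rel equiv_pres_rel])
  fix y z w assume *: "w \<in> gwords X" "(y, z) \<in> pres_rel X R"
  show "pres_rel X R `` {y @ w} = pres_rel X R `` {z @ w}"
    using pres_rel_context[OF *(2) _ *(1), of "[]"] by (simp add: equiv_class_eq[OF equiv_pres_rel])
  show "pres_rel X R `` {w @ y} = pres_rel X R `` {w @ z}"
    using pres_rel_context[OF *(2) *(1), of "[]"] by (simp add: equiv_class_eq[OF equiv_pres_rel])
qed

lemma mult_presented_group:
  assumes "u \<in> gwords X" "v \<in> gwords X"
  shows "(pres_rel X R `` {u}) \<otimes>\<^bsub>presented_group X R\<^esub> (pres_rel X R `` {v})
           = pres_rel X R `` {u @ v}"
  using UN_equiv_class2[OF equiv_pres_rel equiv_pres_rel congruent2_append assms]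
  by (simp add: presented_group_def)

lemma left_inverse_word:
  assumes "w \<in> gwords X"
  shows "\<exists>v \<in> gwords X. (v @ w, []) \<in> pres_rel X R"
  using assms
proof (induction w)
  case Nil
  then show ?case by (auto intro!: bexI[of _ "[]"] pres_rel.refl)
next
  case (Cons l w)
  obtain x b where l: "l = (x, b)" by fastforce
  with Cons obtain v where v: "v \<in> gwords X" "(v @ w, []) \<in> pres_rel X R"
    and "x \<in> X" "w \<in> gwords X" by auto
  then have "((v @ [(x, \<not> b)]) @ l # w, v @ w) \<in> pres_rel X R"
    using pres_rel.cancel[of v X w x "\<not> b" R] l by simp
  with v \<open>x \<in> X\<close> show ?case
    by (intro bexI[of _ "v @ [(x, \<not> b)]"]) (auto intro: pres_rel.trans)
qed

lemma group_presented_group: "group (presented_group X R)"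
proof (rule groupI)
  let ?G = "presented_group X R" and ?c = "\<lambda>w. pres_rel X R `` {w}"
  have in_c: "?c w \<in> carrier ?G" if "w \<in> gwords X" for w
    using that by (simp add: presented_group_def quotientI)
  have E: "\<exists>w \<in> gwords X. A = ?c w" if "A \<in> carrier ?G" for A
    using that by (auto simp: presented_group_def elim: quotientE)
  have one: "\<one>\<^bsub>?G\<^esub> = ?c []"
    by (simp add: presented_group_def)
  show "\<one>\<^bsub>?G\<^esub> \<in> carrier ?G" by (simp add: one in_c)
  fix A assume "A \<in> carrier ?G"
  then obtain a where a: "a \<in> gwords X" "A = ?c a" using E by blast
  show "\<one>\<^bsub>?G\<^esub> \<otimes>\<^bsub>?G\<^esub> A = A" using a by (simp add: one mult_presented_group)
  obtain v where v: "v \<in> gwords X" "(v @ a, []) \<in> pres_rel X R"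
    using left_inverse_word[OF a(1)] by blast
  then have "?c v \<otimes>\<^bsub>?G\<^esub> A = \<one>\<^bsub>?G\<^esub>"
    using a by (simp add: one mult_presented_group equiv_class_eq[OF equiv_pres_rel])
  then show "\<exists>B \<in> carrier ?G. B \<otimes>\<^bsub>?G\<^esub> A = \<one>\<^bsub>?G\<^esub>" using in_c v by blast
  fix B assume "B \<in> carrier ?G"
  then obtain b where b: "b \<in> gwords X" "B = ?c b" using E by blast
  show "A \<otimes>\<^bsub>?G\<^esub> B \<in> carrier ?G" using a b by (simp add: mult_presented_group in_c)
  fix C assume "C \<in> carrier ?G"
  then obtain c where "c \<in> gwords X" "C = ?c c" using E by blast
  then show "A \<otimes>\<^bsub>?G\<^esub> B \<otimes>\<^bsub>?G\<^esub> C = A \<otimes>\<^bsub>?G\<^esub> (B \<otimes>\<^bsub>?G\<^esub> C)"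
    using a b by (simp add: mult_presented_group)
qed


section \<open>Right-angled Artin groups\<close>

text \<open>Finite simplicial graphs are the loop-free symmetric digraphs without parallel arcs of the
  locale \<^locale>\<open>graph\<close>: an edge is a pair of opposite arcs. The relators are the commutators
  \<open>u v u\<inverse> v\<inverse>\<close> of adjacent vertices.\<close>

definition raag :: "('a, 'b) pre_digraph \<Rightarrow> 'a gword set monoid" where
  "raag G = presented_group (verts G)
     {[(u, True), (v, True), (u, False), (v, False)] | u v. u \<rightarrow>\<^bsub>G\<^esub> v}"


section \<open>Commensurability\<close>

definition finite_index_subgroup :: "'g set \<Rightarrow> ('g, 'm) monoid_scheme \<Rightarrow> bool" where
  "finite_index_subgroup H G \<longleftrightarrow> subgroup H G \<and> finite (rcosets\<^bsub>G\<^esub> H)"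

definition commensurable :: "('g, 'm) monoid_scheme \<Rightarrow> ('h, 'n) monoid_scheme \<Rightarrow> bool" where
  "commensurable G H \<longleftrightarrow>
     (\<exists>K L. finite_index_subgroup K G \<and> finite_index_subgroup L H \<and>
            G\<lparr>carrier := K\<rparr> \<cong> H\<lparr>carrier := L\<rparr>)"


section \<open>Separating cliques\<close>

text \<open>For a symmetric digraph the strongly connected components are the connected components.
  The empty graph has none and is therefore not disconnected, although it does not satisfy
  \<^const>\<open>connected\<close> either.\<close>

definition disconnected :: "('a, 'b) pre_digraph \<Rightarrow> bool" where
  "disconnected G \<longleftrightarrow> 2 \<le> card (pre_digraph.sccs G)"

definition separating :: "('a, 'b) pre_digraph \<Rightarrow> ('a, 'b) pre_digraph \<Rightarrow> bool" where
  "separating D G \<longleftrightarrow> induced_subgraph D G \<and> disconnected (G \<restriction> (verts G - verts D))"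

text \<open>A \<open>k\<close>-clique is a complete graph \<^term>\<open>K\<^bsub>k\<^esub>\<close>, which for \<open>k = 0\<close> is the empty graph.\<close>

definition has_separating_clique :: "nat \<Rightarrow> ('a, 'b) pre_digraph \<Rightarrow> bool" where
  "has_separating_clique k G \<longleftrightarrow> (\<exists>D. K\<^bsub>k\<^esub> D \<and> separating D G)"

end

theory Submission
  imports Defs "HOL-Algebra.Generated_Groups" "HOL-Library.Sublist"
begin

text \<open>If \<open>K\<close> is a separating clique of \<open>\<Delta>\<close> with at most \<open>n\<close> vertices, then \<open>A\<^sub>\<Delta>\<close> splits as an
  amalgam over \<open>A\<^sub>K\<close>. Instead of the Bass--Serre tree we use the system of its halfspaces: a family
  of pairwise nested sets, finitely many of which separate two given points, whose stabilizers are
  conjugate to \<open>A\<^sub>K\<close>, free abelian of rank at most \<open>n\<close>. A finite index subgroup \<open>H\<close> of \<open>A\<^sub>\<Gamma>\<close> acts on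
  it. For \<open>g \<in> A\<^sub>\<Gamma>\<close> and a halfspace \<open>h\<close>, the vertices \<open>v\<close> for which a power of \<open>g v g\<inverse>\<close>
  stabilizes \<open>h\<close> form a clique with at most \<open>n\<close> vertices. If a power of \<open>g v g\<inverse>\<close> moved \<open>h\<close> strictly
  into itself, then discreteness would make the link of \<open>v\<close> such a clique too, and it would separate
  \<open>v\<close> from the rest of \<open>\<Gamma>\<close>. So every remaining \<open>g v g\<inverse>\<close> lies on one side of \<open>h\<close>, in the sense that
  \<open>h\<close> or its complement is disjoint from its image. Commuting elements lie on the same side, hence
  the side is independent of \<open>v\<close> because \<open>\<Gamma>\<close> has no small separating clique, and then also
  independent of \<open>g\<close>. This gives an \<open>H\<close>-invariant choice of a side for each halfspace, no two chosen
  sides being disjoint, which is impossible: powers of vertices on the two sides of \<open>K\<close> play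
  ping-pong.\<close>

section \<open>Separating cliques and presented groups\<close>

text \<open>Arcs come with their opposites, so a strong component is closed under arcs. Conversely a
  closed set contains everything reachable from its points, so the component of a point inside it
  differs from that of a point outside.\<close>

lemma disconnected_iff:
  assumes "fin_digraph H" "sym_digraph H"
  shows "disconnected H \<longleftrightarrow> (\<exists>T. T \<noteq> {} \<and> T \<subset> verts H \<and> (\<forall>v\<in>T. \<forall>w. v \<rightarrow>\<^bsub>H\<^esub> w \<longrightarrow> w \<in> T))"
proof -
  interpret fin_digraph H by fact
  interpret sym_digraph H by fact
  have card: "disconnected H \<longleftrightarrow> 2 \<le> card sccs_verts"
    by (simp add: disconnected_def card_sccs_verts)
  show ?thesis
  proof
    assume "disconnected H"
    then obtain S T where ST: "S \<in> sccs_verts" "T \<in> sccs_verts" "S \<noteq> T"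
      unfolding card using card_le_Suc0_iff_eq[OF finite_sccs_verts] by auto
    then have "S \<noteq> {}" "T \<noteq> {}" "S \<subseteq> verts H" "T \<subseteq> verts H"
      using sccs_verts_subsets by (auto simp: in_sccs_verts_conv_reachable)
    moreover have "S \<inter> T = {}" using sccs_verts_disjoint ST by blast
    moreover have closed: "w \<in> S" if "v \<in> S" "v \<rightarrow>\<^bsub>H\<^esub> w" for v w
    proof -
      have "v \<rightarrow>\<^sup>*\<^bsub>H\<^esub> w" "w \<rightarrow>\<^sup>*\<^bsub>H\<^esub> v" 
        using reachable_adjI[OF that(2)] reachable_adjI[OF graph_symmetric[OF that(2)]] by this+
      moreover have "\<forall>v\<in>S. \<forall>w. w \<notin> S \<longrightarrow> \<not> v \<rightarrow>\<^sup>*\<^bsub>H\<^esub> w \<or> \<not> w \<rightarrow>\<^sup>*\<^bsub>H\<^esub> v"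
        using ST(1) unfolding in_sccs_verts_conv_reachable by (elim conjE)
      ultimately show ?thesis using that(1) by metis
    qed
    moreover have "S \<subset> verts H" using \<open>T \<noteq> {}\<close> \<open>S \<subseteq> verts H\<close> \<open>T \<subseteq> verts H\<close> \<open>S \<inter> T = {}\<close> by auto
    ultimately show "\<exists>T. T \<noteq> {} \<and> T \<subset> verts H \<and> (\<forall>v\<in>T. \<forall>w. v \<rightarrow>\<^bsub>H\<^esub> w \<longrightarrow> w \<in> T)"
      by (intro exI[of _ S] conjI ballI allI impI) (assumption | rule closed)+
  next
    assume "\<exists>T. T \<noteq> {} \<and> T \<subset> verts H \<and> (\<forall>v\<in>T. \<forall>w. v \<rightarrow>\<^bsub>H\<^esub> w \<longrightarrow> w \<in> T)"
    then obtain T u w where T: "u \<in> T" "w \<in> verts H" "w \<notin> T" "T \<subset> verts H"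
      and closed: "\<And>v w. v \<in> T \<Longrightarrow> v \<rightarrow>\<^bsub>H\<^esub> w \<Longrightarrow> w \<in> T" by blast
    have "v \<in> T" if "u \<rightarrow>\<^sup>*\<^bsub>H\<^esub> v" for v
      using that by (induction rule: reachable_induct) (use T closed in auto)
    then have "w \<notin> scc_of u" using T by (auto simp: scc_of_def)
    moreover have "w \<in> scc_of w" using T in_scc_of_self by blast
    ultimately have "scc_of u \<noteq> scc_of w" by blast
    moreover have "{scc_of u, scc_of w} \<subseteq> sccs_verts" using T scc_of_in_sccs_verts by auto
    ultimately show "disconnected H"
      unfolding card using card_mono[OF finite_sccs_verts, of "{scc_of u, scc_of w}"] by simp
  qed
qed

definition clique_on :: "('a, 'b) pre_digraph \<Rightarrow> 'a set \<Rightarrow> bool" where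
  "clique_on G S \<longleftrightarrow> S \<subseteq> verts G \<and> (\<forall>u\<in>S. \<forall>v\<in>S. u \<noteq> v \<longrightarrow> u \<rightarrow>\<^bsub>G\<^esub> v)"

text \<open>An induced subgraph is determined by its vertex set, which lets a set \<open>S\<close>
  replace the graph \<open>D\<close>. The set \<open>T\<close> is a union of some but not all
  components of the rest.\<close>

lemma has_separating_clique_iff:
  assumes "graph G"
  shows "has_separating_clique k G \<longleftrightarrow> (\<exists>S T. clique_on G S \<and> card S = k \<and>
    T \<noteq> {} \<and> T \<subset> verts G - S \<and> (\<forall>v\<in>T. \<forall>w \<in> verts G - S. v \<rightarrow>\<^bsub>G\<^esub> w \<longrightarrow> w \<in> T))"
proof -
  interpret graph G by fact
  have graph_induce: "graph (G \<restriction> U)" if "U \<subseteq> verts G" for U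
    using induced_induce[OF that] digraph_subgraph induced_graph_imp_graph
    by (metis digraph_def graph_def induced_imp_subgraph pseudo_graph_def)
  have arc: "v \<rightarrow>\<^bsub>G \<restriction> U\<^esub> w \<longleftrightarrow> v \<in> U \<and> w \<in> U \<and> v \<rightarrow>\<^bsub>G\<^esub> w" for U v w
    by (auto simp: induce_subgraph_def arcs_ends_def arc_to_ends_def)
  have disc: "disconnected (G \<restriction> (verts G - S)) \<longleftrightarrow> (\<exists>T. T \<noteq> {} \<and> T \<subset> verts G - S \<and>
      (\<forall>v\<in>T. \<forall>w \<in> verts G - S. v \<rightarrow>\<^bsub>G\<^esub> w \<longrightarrow> w \<in> T))" for S
  proof -
    have "graph (G \<restriction> (verts G - S))" by (rule graph_induce) auto
    then have "fin_digraph (G \<restriction> (verts G - S))" "sym_digraph (G \<restriction> (verts G - S))"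
      by (simp_all add: graph_def digraph_def pseudo_graph_def)
    from disconnected_iff[OF this] have "disconnected (G \<restriction> (verts G - S)) \<longleftrightarrow> (\<exists>T. T \<noteq> {} \<and> T \<subset> verts G - S \<and>
      (\<forall>v\<in>T. \<forall>w. v \<in> verts G - S \<and> w \<in> verts G - S \<and> v \<rightarrow>\<^bsub>G\<^esub> w \<longrightarrow> w \<in> T))"
      unfolding arc induce_subgraph_verts .
    moreover have "(\<forall>v\<in>T. \<forall>w. v \<in> verts G - S \<and> w \<in> verts G - S \<and> v \<rightarrow>\<^bsub>G\<^esub> w \<longrightarrow> w \<in> T) \<longleftrightarrow>
      (\<forall>v\<in>T. \<forall>w \<in> verts G - S. v \<rightarrow>\<^bsub>G\<^esub> w \<longrightarrow> w \<in> T)" if "T \<subset> verts G - S" for T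
      using that by auto
    ultimately show ?thesis by (auto simp del: psubset_eq cong: conj_cong)
  qed
  have clique: "\<exists>D. K\<^bsub>card S\<^esub> D \<and> induced_subgraph D G \<and> verts D = S" if "clique_on G S" for S
  proof (intro exI conjI)
    have S: "S \<subseteq> verts G" using that by (simp add: clique_on_def)
    show "induced_subgraph (G \<restriction> S) G" using S by (rule induced_induce)
    show "verts (G \<restriction> S) = S" by simp
    have "graph (G \<restriction> S)" using S by (rule graph_induce)
    moreover have "arcs_ends (G \<restriction> S) = {(u, v). (u, v) \<in> S \<times> S \<and> u \<noteq> v}"
      using that arc[of _ _ S] adj_not_same by (auto simp: clique_on_def)
    ultimately show "K\<^bsub>card S\<^esub> (G \<restriction> S)" by (simp add: complete_digraph_def)
  qed
  have "clique_on G (verts D) \<and> card (verts D) = k" if "K\<^bsub>k\<^esub> D" "induced_subgraph D G" for D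
    using that arcs_ends_mono[of D G] unfolding complete_digraph_def clique_on_def
    by (auto simp: induced_subgraph_def subgraph_def)
  then have "has_separating_clique k G \<longleftrightarrow> (\<exists>S. clique_on G S \<and> card S = k \<and> disconnected (G \<restriction> (verts G - S)))"
    unfolding has_separating_clique_def separating_def by (blast dest: clique)
  then show ?thesis unfolding disc by blast
qed

section \<open>Elements of a right-angled Artin group as classes of words\<close>

lemma gwords_iff: "w \<in> gwords X \<longleftrightarrow> fst ` set w \<subseteq> X"
  by (induction w) auto

definition raag_relators :: "('a, 'b) pre_digraph \<Rightarrow> 'a gword set" where
  "raag_relators G = {[(u, True), (v, True), (u, False), (v, False)] | u v. u \<rightarrow>\<^bsub>G\<^esub> v}"

definition word_class :: "('a, 'b) pre_digraph \<Rightarrow> 'a gword \<Rightarrow> 'a gword set" where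
  "word_class G w = pres_rel (verts G) (raag_relators G) `` {w}"

lemma raag_altdef: "raag G = presented_group (verts G) (raag_relators G)"
  by (simp add: raag_def raag_relators_def)

lemma group_raag: "group (raag G)"
  by (simp add: raag_altdef group_presented_group)

lemma word_class_carrier [simp, intro]: "w \<in> gwords (verts G) \<Longrightarrow> word_class G w \<in> carrier (raag G)"
  by (simp add: word_class_def raag_altdef presented_group_def quotientI)

lemma raag_carrierE:
  assumes "A \<in> carrier (raag G)"
  obtains w where "w \<in> gwords (verts G)" "A = word_class G w"
  using assms by (auto simp: word_class_def raag_altdef presented_group_def elim: quotientE)

lemma raag_one: "\<one>\<^bsub>raag G\<^esub> = word_class G []"
  by (simp add: word_class_def raag_altdef presented_group_def)

lemma raag_mult:
  "u \<in> gwords (verts G) \<Longrightarrow> v \<in> gwords (verts G) \<Longrightarrow>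
     word_class G u \<otimes>\<^bsub>raag G\<^esub> word_class G v = word_class G (u @ v)"
  by (simp add: word_class_def raag_altdef mult_presented_group)

lemma word_class_eqI:
  "(u, v) \<in> pres_rel (verts G) (raag_relators G) \<Longrightarrow> word_class G u = word_class G v"
  unfolding word_class_def by (rule equiv_class_eq[OF equiv_pres_rel])

lemma word_class_cancel:
  "x \<in> verts G \<Longrightarrow> word_class G [(x, b), (x, \<not> b)] = word_class G []"
  using pres_rel.cancel[of "[]" "verts G" "[]" x b "raag_relators G"] by (simp add: word_class_eqI)

section \<open>Actions given letter by letter\<close>

definition word_eval :: "('a \<times> bool \<Rightarrow> 's \<Rightarrow> 's) \<Rightarrow> 'a gword set \<Rightarrow> 's \<Rightarrow> 's" where
  "word_eval f A = foldr f (SOME w. w \<in> A)"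

text \<open>Commutation of inverse letters suffices: a relator first applies its two inverse
  letters, and after swapping them everything cancels. Hence \<open>word_eval\<close> does not
  depend on the word picked by \<open>SOME\<close>.\<close>

locale raag_action = graph G for G :: "('a, 'b) pre_digraph" +
  fixes f :: "'a \<times> bool \<Rightarrow> 's \<Rightarrow> 's" and S :: "'s set"
  assumes letter_closed: "x \<in> verts G \<Longrightarrow> s \<in> S \<Longrightarrow> f (x, b) s \<in> S"
    and letter_cancel: "x \<in> verts G \<Longrightarrow> s \<in> S \<Longrightarrow> f (x, b) (f (x, \<not> b) s) = s"
    and letter_commute: "u \<rightarrow>\<^bsub>G\<^esub> v \<Longrightarrow> s \<in> S \<Longrightarrow> f (u, False) (f (v, False) s) = f (v, False) (f (u, False) s)"
begin

lemma foldr_closed: "w \<in> gwords (verts G) \<Longrightarrow> s \<in> S \<Longrightarrow> foldr f w s \<in> S"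
  by (induction w) (auto simp: letter_closed)

lemma foldr_respects:
  assumes "(u, v) \<in> pres_rel (verts G) (raag_relators G)" "s \<in> S"
  shows "foldr f u s = foldr f v s"
  using assms
proof (induction rule: pres_rel.induct)
  case (cancel u v x b)
  then show ?case using letter_cancel[of x "foldr f v s" b] foldr_closed by simp
next
  case (relator u v r)
  then obtain x y where r: "r = [(x, True), (y, True), (x, False), (y, False)]" and xy: "x \<rightarrow>\<^bsub>G\<^esub> y"
    by (auto simp: raag_relators_def)
  let ?t = "foldr f v s"
  have V: "x \<in> verts G" "y \<in> verts G" using xy adj_in_verts by blast+
  have t: "?t \<in> S" using relator foldr_closed by blast
  have "f (x, True) (f (y, True) (f (x, False) (f (y, False) ?t))) = ?t"
    using letter_cancel[of _ _ True] letter_commute[OF xy t] V t letter_closed by simp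
  then show ?case using r by simp
qed auto

lemma word_eval_class:
  assumes "w \<in> gwords (verts G)" "s \<in> S"
  shows "word_eval f (word_class G w) s = foldr f w s"
proof -
  have "w \<in> word_class G w" using assms by (auto simp: word_class_def intro: pres_rel.refl)
  then have "(SOME v. v \<in> word_class G w) \<in> word_class G w" by (rule someI)
  then show ?thesis unfolding word_eval_def
    using foldr_respects assms by (force simp: word_class_def)
qed

lemma word_eval_closed: "A \<in> carrier (raag G) \<Longrightarrow> s \<in> S \<Longrightarrow> word_eval f A s \<in> S"
  by (elim raag_carrierE) (simp add: word_eval_class foldr_closed)

lemma word_eval_mult:
  assumes "A \<in> carrier (raag G)" "B \<in> carrier (raag G)" "s \<in> S"
  shows "word_eval f (A \<otimes>\<^bsub>raag G\<^esub> B) s = word_eval f A (word_eval f B s)"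
  using assms by (elim raag_carrierE) (simp add: raag_mult word_eval_class foldr_closed)

lemma word_eval_one: "s \<in> S \<Longrightarrow> word_eval f \<one>\<^bsub>raag G\<^esub> s = s"
  by (simp add: raag_one word_eval_class)

end

abbreviation raag_gen :: "('a, 'b) pre_digraph \<Rightarrow> 'a \<Rightarrow> 'a gword set" where
  "raag_gen G v \<equiv> word_class G [(v, True)]"

text \<open>The exponent sum of \<open>v\<close>, read off as the image of 0 when \<open>v\<close>
  acts on the integers by adding 1 and all other generators act trivially.\<close>

definition exponent :: "'a \<Rightarrow> 'a gword set \<Rightarrow> int" where
  "exponent v A = word_eval (\<lambda>(x, b) i. if x = v then (if b then i + 1 else i - 1) else i) A 0"

context graph
begin

lemma raag_action_exponent:
  "raag_action G (\<lambda>(x, b) i. if x = v then (if b then i + 1 else i - 1) else (i::int)) UNIV"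
  by unfold_locales auto

lemma exponent_class:
  "w \<in> gwords (verts G) \<Longrightarrow> exponent v (word_class G w) =
     foldr (\<lambda>(x, b) i. if x = v then (if b then i + 1 else i - 1) else i) w 0"
  unfolding exponent_def by (rule raag_action.word_eval_class[OF raag_action_exponent]) auto

lemma exponent_mult:
  assumes "A \<in> carrier (raag G)" "B \<in> carrier (raag G)"
  shows "exponent v (A \<otimes>\<^bsub>raag G\<^esub> B) = exponent v A + exponent v B"
proof -
  let ?f = "\<lambda>(x, b) i. if x = v then (if b then i + 1 else i - 1) else (i::int)"
  have shift: "foldr ?f w i = foldr ?f w 0 + i" for w i
    by (induction w) (auto split: prod.splits)
  obtain u w where "u \<in> gwords (verts G)" "A = word_class G u" "w \<in> gwords (verts G)" "B = word_class G w"
    using assms by (elim raag_carrierE)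
  then show ?thesis
    using shift[of u "foldr ?f w 0"] by (simp add: raag_mult exponent_class)
qed

lemma exponent_gen: "u \<in> verts G \<Longrightarrow> exponent v (raag_gen G u) = (if u = v then 1 else 0)"
  by (simp add: exponent_class)

lemma raag_gen_commute:
  assumes "u \<rightarrow>\<^bsub>G\<^esub> v"
  shows "raag_gen G u \<otimes>\<^bsub>raag G\<^esub> raag_gen G v = raag_gen G v \<otimes>\<^bsub>raag G\<^esub> raag_gen G u"
proof -
  have V: "u \<in> verts G" "v \<in> verts G" using assms adj_in_verts by blast+
  \<comment> \<open>The word \<open>u v u\<inverse> v\<inverse> v u\<close> equals
    \<open>v u\<close> by the relator and \<open>u v\<close> by two cancellations.\<close>
  have "([(u, True), (v, True), (u, False), (v, False)] @ [(v, True), (u, True)], [(v, True), (u, True)])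
     \<in> pres_rel (verts G) (raag_relators G)"
    using pres_rel.relator[of "[]" "verts G" "[(v, True), (u, True)]" "[(u, True), (v, True), (u, False), (v, False)]" "raag_relators G"]
      V assms by (auto simp: raag_relators_def)
  moreover have "([(u, True), (v, True), (u, False)] @ [(v, False), (v, True)] @ [(u, True)], [(u, True), (v, True), (u, False)] @ [(u, True)])
     \<in> pres_rel (verts G) (raag_relators G)"
    using V pres_rel.cancel[of "[(u, True), (v, True), (u, False)]" "verts G" "[(u, True)]" v False] by simp
  moreover have "([(u, True), (v, True)] @ [(u, False), (u, True)] @ [], [(u, True), (v, True)] @ [])
     \<in> pres_rel (verts G) (raag_relators G)"
    using V pres_rel.cancel[of "[(u, True), (v, True)]" "verts G" "[]" u False] by simp
  ultimately have "word_class G [(u, True), (v, True)] = word_class G [(v, True), (u, True)]"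
    by (auto dest!: word_class_eqI)
  then show ?thesis using V by (simp add: raag_mult)
qed

end


section \<open>Powers, subgroups and additive invariants\<close>

context group
begin

lemma subgroup_nat_pow_closed: "subgroup D G \<Longrightarrow> x \<in> D \<Longrightarrow> x [^] (n::nat) \<in> D"
  using subgroup_int_pow_closed[of D x "int n"] by (simp add: int_pow_int)

lemma subgroup_centralizer:
  assumes "y \<in> carrier G"
  shows "subgroup {x \<in> carrier G. x \<otimes> y = y \<otimes> x} G"
proof (rule subgroupI)
  fix a assume "a \<in> {x \<in> carrier G. x \<otimes> y = y \<otimes> x}"
  then have a: "a \<in> carrier G" "a \<otimes> y = y \<otimes> a" by auto
  then have "inv a \<otimes> (a \<otimes> y) \<otimes> inv a = inv a \<otimes> (y \<otimes> a) \<otimes> inv a" by simp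
  then have "y \<otimes> inv a = inv a \<otimes> y" using a(1) assms
    by (metis inv_closed l_inv l_one m_assoc m_closed r_inv r_one)
  then show "inv a \<in> {x \<in> carrier G. x \<otimes> y = y \<otimes> x}" using a by simp
next
  fix a b assume "a \<in> {x \<in> carrier G. x \<otimes> y = y \<otimes> x}" "b \<in> {x \<in> carrier G. x \<otimes> y = y \<otimes> x}"
  then have "a \<in> carrier G" "b \<in> carrier G" "a \<otimes> y = y \<otimes> a" "b \<otimes> y = y \<otimes> b" by auto
  then show "a \<otimes> b \<in> {x \<in> carrier G. x \<otimes> y = y \<otimes> x}"
    using assms by (simp add: m_assoc) (metis m_assoc)
qed (use assms in auto)

text \<open>Centralizers are subgroups, hence closed under powers; this is applied to one factor
  after the other.\<close>

lemma int_pow_commute: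
  assumes "x \<in> carrier G" "y \<in> carrier G" "x \<otimes> y = y \<otimes> x"
  shows "x [^] (i::int) \<otimes> y [^] (j::int) = y [^] j \<otimes> x [^] i"
proof -
  have "x [^] i \<otimes> y = y \<otimes> x [^] i"
    using subgroup_int_pow_closed[OF subgroup_centralizer[of y], of x i] assms by simp
  then show ?thesis
    using subgroup_int_pow_closed[OF subgroup_centralizer[of "x [^] i"], of y j] assms by simp
qed

lemma nat_pow_commute:
  assumes "x \<in> carrier G" "y \<in> carrier G" "x \<otimes> y = y \<otimes> x"
  shows "x [^] (i::nat) \<otimes> y [^] (j::nat) = y [^] j \<otimes> x [^] i"
  using int_pow_commute[OF assms, of "int i" "int j"] by (simp add: int_pow_int)

lemma nat_pow_conjugate:
  assumes "k \<in> carrier G" "x \<in> carrier G"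
  shows "(k \<otimes> x \<otimes> inv k) [^] (n::nat) = k \<otimes> x [^] n \<otimes> inv k"
proof (induction n)
  case (Suc n)
  have "k \<otimes> x [^] n \<otimes> inv k \<otimes> (k \<otimes> x \<otimes> inv k) = k \<otimes> x [^] n \<otimes> (inv k \<otimes> k) \<otimes> x \<otimes> inv k"
    using assms by (simp add: m_assoc inv_solve_left')
  then show ?case using Suc assms by (simp add: m_assoc)
qed (use assms in simp)

lemma additive_int_pow:
  fixes \<chi> :: "'a \<Rightarrow> int"
  assumes "subgroup D G" "\<And>x y. x \<in> D \<Longrightarrow> y \<in> D \<Longrightarrow> \<chi> (x \<otimes> y) = \<chi> x + \<chi> y" "x \<in> D"
  shows "\<chi> (x [^] (i::int)) = i * \<chi> x"
proof -
  interpret D: subgroup D G by fact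
  have one: "\<chi> \<one> = 0" using assms(2)[of \<one> \<one>] by simp
  have nat: "\<chi> (x [^] n) = int n * \<chi> x" for n :: nat
    by (induction n) (use assms one subgroup_nat_pow_closed in \<open>auto simp: algebra_simps\<close>)
  show ?thesis
  proof (cases i)
    case (nonneg n)
    then show ?thesis using nat by (simp add: int_pow_int)
  next
    case (neg n)
    let ?y = "x [^] Suc n"
    have y: "?y \<in> D" by (rule subgroup_nat_pow_closed) fact+
    have "\<chi> (inv ?y) + \<chi> ?y = 0"
      using assms(2)[of "inv ?y" ?y] y one by (simp del: nat_pow_Suc)
    moreover have "x [^] i = inv ?y"
      unfolding neg using assms(3) by (intro int_pow_neg_int) auto
    ultimately show ?thesis using nat[of "Suc n"] unfolding neg by (simp add: algebra_simps)
  qed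
qed

text \<open>The maps \<open>\<epsilon> k\<close> embed \<open>D\<close> into a free abelian group of
  rank \<open>card K\<close>, where the \<open>z s\<close> are independent because each
  \<open>\<chi> s\<close> detects exactly one of them. Induction on \<open>K\<close> is Gaussian
  elimination without division: restrict to the kernel of one \<open>\<epsilon> k\<close> and give
  up at most one element of \<open>S\<close>.\<close>

lemma independent_card_le:
  fixes \<epsilon> :: "'k \<Rightarrow> 'a \<Rightarrow> int" and \<chi> :: "'s \<Rightarrow> 'a \<Rightarrow> int"
  assumes "finite K" "subgroup D G" "finite S"
    and "\<And>k x y. k \<in> K \<Longrightarrow> x \<in> D \<Longrightarrow> y \<in> D \<Longrightarrow> \<epsilon> k (x \<otimes> y) = \<epsilon> k x + \<epsilon> k y"
    and "\<And>x. x \<in> D \<Longrightarrow> \<forall>k\<in>K. \<epsilon> k x = 0 \<Longrightarrow> x = \<one>"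
    and "\<And>s x y. s \<in> S \<Longrightarrow> x \<in> D \<Longrightarrow> y \<in> D \<Longrightarrow> \<chi> s (x \<otimes> y) = \<chi> s x + \<chi> s y"
    and "\<And>s. s \<in> S \<Longrightarrow> z s \<in> D"
    and "\<And>s t. s \<in> S \<Longrightarrow> t \<in> S \<Longrightarrow> \<chi> s (z t) \<noteq> 0 \<longleftrightarrow> s = t"
  shows "card S \<le> card K"
  using assms
proof (induction K arbitrary: D S z rule: finite_induct)
  case empty
  have False if "s \<in> S" for s
  proof -
    have "z s = \<one>" using empty that by blast
    moreover have "\<chi> s (z s) \<noteq> 0" using empty that by blast
    moreover have "\<chi> s (\<one> \<otimes> \<one>) = \<chi> s \<one> + \<chi> s \<one>"
      using empty.prems that subgroup.one_closed[of D G] by blast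
    ultimately show False by simp
  qed
  then have "S = {}" by blast
  then show ?case by simp
next
  case (insert k K)
  interpret D: subgroup D G by fact
  let ?D = "{x \<in> D. \<epsilon> k x = 0}"
  have \<epsilon>k: "\<epsilon> k (x \<otimes> y) = \<epsilon> k x + \<epsilon> k y" if "x \<in> D" "y \<in> D" for x y
    using insert.prems(3) that by simp
  have pow: "\<epsilon> k (x [^] i) = i * \<epsilon> k x" if "x \<in> D" for x and i :: int
    by (rule additive_int_pow[OF D.subgroup_axioms]) (use \<epsilon>k that in auto)
  have one: "\<epsilon> k \<one> = 0" using \<epsilon>k[of \<one> \<one>] by simp
  have subD: "subgroup ?D G"
  proof (rule subgroupI)
    fix a assume a: "a \<in> ?D"
    then have "\<epsilon> k (inv a) = 0" using \<epsilon>k[of "inv a" a] one by simp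
    then show "inv a \<in> ?D" using a by simp
  next
    show "?D \<noteq> {}" using one D.one_closed by blast
  qed (use \<epsilon>k in auto)
  have step: "card T \<le> card K" if "finite T" "T \<subseteq> S" "\<And>s. s \<in> T \<Longrightarrow> w s \<in> ?D"
    "\<And>s t. s \<in> T \<Longrightarrow> t \<in> T \<Longrightarrow> \<chi> s (w t) \<noteq> 0 \<longleftrightarrow> s = t" for T w
  proof (rule insert.IH[of ?D T w])
    show "subgroup ?D G" by (fact subD)
  qed (use that insert.prems in \<open>auto simp: subset_eq\<close>)
  show ?case
  proof (cases "\<forall>s\<in>S. \<epsilon> k (z s) = 0")
    case True
    then have "card S \<le> card K" using step[of S z] insert.prems by simp
    then show ?thesis using insert.hyps by simp
  next
    case False
    then obtain s0 where s0: "s0 \<in> S" "\<epsilon> k (z s0) \<noteq> 0" by blast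
    \<comment> \<open>The exponents make the two contributions to \<open>\<epsilon> k\<close>
      cancel. For \<open>s \<noteq> s0\<close>, \<open>\<chi> s\<close> vanishes on
      \<open>z s0\<close>, so its value on \<open>w t\<close> is that on \<open>z t\<close> times
      the nonzero \<open>\<epsilon> k (z s0)\<close>.\<close>
    define w where "w s = z s [^] \<epsilon> k (z s0) \<otimes> z s0 [^] (- \<epsilon> k (z s))" for s
    have zD: "z s \<in> D" if "s \<in> S" for s using insert.prems(6) that by simp
    have pD: "z s [^] (i::int) \<in> D" if "s \<in> S" for s i
      using subgroup_int_pow_closed[OF D.subgroup_axioms zD[OF that]] .
    have wD: "w s \<in> ?D" if "s \<in> S - {s0}" for s
      unfolding w_def using that s0 \<epsilon>k[OF pD pD, of s s0] pD pow zD by (simp add: D.m_closed)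
    have w\<chi>: "\<chi> s (w t) \<noteq> 0 \<longleftrightarrow> s = t" if "s \<in> S - {s0}" "t \<in> S - {s0}" for s t
    proof -
      have add: "\<chi> s (x \<otimes> y) = \<chi> s x + \<chi> s y" if "x \<in> D" "y \<in> D" for x y
        using insert.prems(5)[of s x y] that \<open>s \<in> S - {s0}\<close> by simp
      have "\<chi> s (z s0) = 0" using insert.prems(7)[of s s0] that s0 by auto
      then have "\<chi> s (w t) = \<epsilon> k (z s0) * \<chi> s (z t)"
        unfolding w_def
        using add[OF pD pD, of t s0] additive_int_pow[of D "\<chi> s", OF D.subgroup_axioms add zD] that s0 by simp
      then show ?thesis using s0 insert.prems(7)[of s t] that by auto
    qed
    have "card (S - {s0}) \<le> card K"
      by (rule step[OF _ _ wD w\<chi>]) (use insert.prems(2) in auto)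
    then show ?thesis using insert s0 by (simp add: card_Diff_singleton)
  qed
qed

text \<open>By pigeonhole two powers \<open>x [^] i\<close> and \<open>x [^] j\<close> with
  \<open>i < j\<close> lie in the same coset, and then \<open>x [^] (j - i)\<close> lies in
  \<open>H\<close>.\<close>

lemma finite_index_power:
  assumes "finite_index_subgroup H G" "x \<in> carrier G"
  shows "\<exists>m>0. x [^] (m::nat) \<in> H"
proof -
  interpret H: subgroup H G using assms by (simp add: finite_index_subgroup_def)
  have "range (\<lambda>n::nat. H #> x [^] n) \<subseteq> rcosets H"
    using assms(2) H.subset by (auto intro: rcosetsI)
  then have "finite (range (\<lambda>n::nat. H #> x [^] n))"
    using assms(1) finite_subset by (auto simp: finite_index_subgroup_def)
  then have "\<not> inj (\<lambda>n::nat. H #> x [^] n)"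
    using finite_imageD infinite_UNIV_nat by blast
  then obtain i j :: nat where ij: "i < j" "H #> x [^] i = H #> x [^] j"
    unfolding inj_on_def by (auto simp: neq_iff dest: sym)
  have "x [^] j \<in> H #> x [^] i"
    using rcos_self[OF _ H.subgroup_axioms, of "x [^] j"] ij assms by simp
  then obtain h where h: "h \<in> H" "x [^] j = h \<otimes> x [^] i" by (auto simp: r_coset_def)
  have "x [^] j = x [^] (j - i) \<otimes> x [^] i" using ij assms by (simp add: nat_pow_mult)
  then have "x [^] (j - i) = h" using h assms by (metis H.mem_carrier nat_pow_closed right_cancel)
  then show ?thesis using h ij by (intro exI[of _ "j - i"]) auto
qed

end


section \<open>Group actions on systems of halfspaces\<close>

locale halfspaces =
  fixes V :: "'v set" and W :: "'v set set"
  assumes subset: "h \<in> W \<Longrightarrow> h \<subseteq> V"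
    and nonempty: "h \<in> W \<Longrightarrow> h \<noteq> {}"
    and compl: "h \<in> W \<Longrightarrow> V - h \<in> W"
    and nested: "h \<in> W \<Longrightarrow> k \<in> W \<Longrightarrow> h \<subseteq> k \<or> k \<subseteq> h \<or> h \<inter> k = {} \<or> h \<union> k = V"
    and finite_separating: "a \<in> V \<Longrightarrow> b \<in> V \<Longrightarrow> finite {h \<in> W. a \<in> h \<and> b \<notin> h}"
begin

text \<open>A point of \<open>h\<close> and a point outside \<open>k\<close> are separated by every
  halfspace between \<open>h\<close> and \<open>k\<close>.\<close>

lemma finite_interval:
  assumes "h \<in> W" "k \<in> W"
  shows "finite {l \<in> W. h \<subseteq> l \<and> l \<subseteq> k}"
proof -
  obtain a b where "a \<in> h" "b \<in> V - k"
    using assms nonempty[of h] nonempty[of "V - k"] compl by blast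
  then have "{l \<in> W. h \<subseteq> l \<and> l \<subseteq> k} \<subseteq> {l \<in> W. a \<in> l \<and> b \<notin> l}" "a \<in> V" "b \<in> V"
    using subset[OF assms(1)] by auto
  then show ?thesis using finite_separating finite_subset by blast
qed

lemma no_infinite_chain:
  assumes "\<And>n::nat. f n \<in> W" "\<And>n. f n \<subset> f (Suc n)" "k \<in> W"
  shows "\<exists>n. \<not> f n \<subseteq> k"
proof (rule ccontr)
  assume "\<not> ?thesis"
  moreover have "f 0 \<subseteq> f n" for n by (induction n) (use assms(2) in auto)
  ultimately have "range f \<subseteq> {l \<in> W. f 0 \<subseteq> l \<and> l \<subseteq> k}" using assms(1) by auto
  then have "finite (range f)" using finite_interval assms finite_subset by meson
  moreover have "strict_mono f" using assms(2) by (simp add: strict_mono_Suc_iff)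
  ultimately show False
    using finite_imageD infinite_UNIV_nat strict_mono_imp_inj_on by blast
qed

text \<open>Here \<open>u i j\<close> stands for the translate of a halfspace by \<open>x\<^sup>i y\<^sup>j\<close>, where \<open>x\<close> and \<open>y\<close> commute
  and \<open>x\<close> shifts the halfspace strictly into itself. The translates are then linearly ordered,
  and finiteness of intervals acts as an Archimedean property.\<close>

lemma commuting_translates_recur:
  fixes u :: "int \<Rightarrow> int \<Rightarrow> 'v set"
  assumes W: "\<And>i j. u i j \<in> W"
    and mono: "\<And>i j i' j' a b. u i j \<subseteq> u i' j' \<Longrightarrow> u (i + a) (j + b) \<subseteq> u (i' + a) (j' + b)"
    and disj: "\<And>i j i' j' a b. u i j \<inter> u i' j' = {} \<Longrightarrow> u (i + a) (j + b) \<inter> u (i' + a) (j' + b) = {}"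
    and cover: "\<And>i j i' j' a b. u i j \<union> u i' j' = V \<Longrightarrow> u (i + a) (j + b) \<union> u (i' + a) (j' + b) = V"
    and strict: "u 1 0 \<subset> u 0 0"
  shows "\<exists>i j. 0 < j \<and> u i j = u 0 0"
proof -
  have dec: "u (i + 1) j \<subset> u i j" for i j
  proof
    show "u (i + 1) j \<subseteq> u i j" using mono[of 1 0 0 0 i j] strict by (auto simp: add.commute)
    show "u (i + 1) j \<noteq> u i j"
      using mono[of i j "i + 1" j "- i" "- j"] strict by auto
  qed
  have anti: "u (i + int n) j \<subseteq> u i j" for i j n
  proof (induction n)
    case (Suc n)
    then show ?case using dec[of "i + int n" j] by (auto simp: ac_simps)
  qed simp
  have up: "\<exists>n::nat. \<not> u (i - int n) j \<subseteq> k" if "k \<in> W" for i j k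
  proof (rule no_infinite_chain[OF _ _ that])
    show "u (i - int n) j \<subset> u (i - int (Suc n)) j" for n
      using dec[of "i - int (Suc n)" j] by (simp add: algebra_simps)
  qed (rule W)
  have down: "\<exists>n::nat. \<not> k \<subseteq> u (i + int n) j" if "k \<in> W" for i j k
  proof -
    have "\<exists>n::nat. \<not> V - u (i + int n) j \<subseteq> V - k"
    proof (rule no_infinite_chain)
      show "V - u (i + int n) j \<subset> V - u (i + int (Suc n)) j" for n
        using dec[of "i + int n" j] subset[OF W, of "i + int n" j] by (auto simp: ac_simps)
    qed (use W that compl in auto)
    then show ?thesis using subset[OF that] by blast
  qed
  \<comment> \<open>If two translates were disjoint, applying negative powers of \<open>x\<close>
    would give an ascending chain bounded by a complement, against \<open>up\<close>. If they
    covered \<open>V\<close>, positive powers would give a descending chain bounded below, against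
    \<open>down\<close>.\<close>
  have comparable: "u i 0 \<subseteq> u i' j \<or> u i' j \<subseteq> u i 0" for i i' j
  proof (rule ccontr)
    assume "\<not> ?thesis"
    then consider "u i 0 \<inter> u i' j = {}" | "u i 0 \<union> u i' j = V" using nested[OF W W] by blast
    then show False
    proof cases
      case 1
      have "u (i - int n) 0 \<subseteq> V - u i' j" for n
        using disj[OF 1, of "- int n" 0] anti[of "i' - int n" n j] subset[OF W, of "i - int n" 0] by auto
      then show False using up[OF compl[OF W]] by blast
    next
      case 2
      have "V - u i' j \<subseteq> u (i + int n) 0" for n
        using cover[OF 2, of "int n" 0] anti[of "i'" n j] by auto
      then show False using down[OF compl[OF W]] by blast
    qed
  qed
  \<comment> \<open>Take the first index in row \<open>j\<close> at which the translate stops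
    containing \<open>u 0 0\<close>. It lies inside \<open>u 0 0\<close> by comparability and
    contains \<open>u 1 0\<close> because its predecessor contains \<open>u 0 0\<close>.\<close>
  have "\<exists>i. u 1 0 \<subseteq> u i j \<and> u i j \<subseteq> u 0 0" for j
  proof -
    obtain m where "\<not> u (0 - int m) j \<subseteq> u 0 0" using up[OF W] by blast
    then have m: "u 0 0 \<subseteq> u (- int m) j" using comparable by auto
    have "\<exists>n. u 0 0 \<subseteq> u (- int m + int n) j \<and> \<not> u 0 0 \<subseteq> u (- int m + int (Suc n)) j"
    proof (rule ccontr)
      assume neg: "\<not> ?thesis"
      have "u 0 0 \<subseteq> u (- int m + int n) j" for n
        by (induction n) (use m neg in auto)
      then show False using down[OF W] by blast
    qed
    then obtain n where n: "u 0 0 \<subseteq> u (- int m + int n) j" "\<not> u 0 0 \<subseteq> u (- int m + int (Suc n)) j" by blast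
    have "u 1 0 \<subseteq> u (- int m + int (Suc n)) j" using mono[OF n(1), of 1 0] by (simp add: ac_simps)
    then show ?thesis using n(2) comparable by blast
  qed
  then obtain c where c: "\<And>j. u 1 0 \<subseteq> u (c j) j \<and> u (c j) j \<subseteq> u 0 0" by metis
  \<comment> \<open>Infinitely many rows meet one finite interval, so two of the chosen translates
    coincide; shifting one of them back to \<open>u 0 0\<close> gives the recurrence.\<close>
  then have "range (\<lambda>n::nat. u (c (int n)) (int n)) \<subseteq> {l \<in> W. u 1 0 \<subseteq> l \<and> l \<subseteq> u 0 0}" using W by auto
  then have "finite (range (\<lambda>n::nat. u (c (int n)) (int n)))"
    by (rule finite_subset[OF _ finite_interval[OF W W]])
  then have "\<not> inj (\<lambda>n::nat. u (c (int n)) (int n))" using finite_imageD infinite_UNIV_nat by blast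
  then obtain m n :: nat where mn: "m < n" "u (c (int m)) (int m) = u (c (int n)) (int n)"
    unfolding inj_on_def by (auto simp: neq_iff dest: sym)
  then have "u (c (int n) - c (int m)) (int n - int m) = u 0 0"
    using mono[of "c (int m)" "int m" "c (int n)" "int n" "- c (int m)" "- int m"]
      mono[of "c (int n)" "int n" "c (int m)" "int m" "- c (int m)" "- int m"] by auto
  then show ?thesis using mn(1) by (intro exI[of _ "c (int n) - c (int m)"] exI[of _ "int n - int m"]) simp
qed

end

text \<open>Only \<open>H\<close> acts, but \<open>power_in_H\<close> lets every element of
  \<open>G\<close> be tested on a halfspace through its powers.\<close>

locale virtual_action = group G + halfspaces V W
  for G :: "('g, 'm) monoid_scheme" (structure) and V :: "'v set" and W :: "'v set set" +
  fixes H :: "'g set" and act :: "'g \<Rightarrow> 'v \<Rightarrow> 'v"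
  assumes subgroup_H: "subgroup H G"
    and power_in_H: "x \<in> carrier G \<Longrightarrow> \<exists>m>0. x [^] (m::nat) \<in> H"
    and act_closed: "z \<in> H \<Longrightarrow> a \<in> V \<Longrightarrow> act z a \<in> V"
    and act_one: "a \<in> V \<Longrightarrow> act \<one> a = a"
    and act_mult: "y \<in> H \<Longrightarrow> z \<in> H \<Longrightarrow> a \<in> V \<Longrightarrow> act (y \<otimes> z) a = act y (act z a)"
    and translate_W: "z \<in> H \<Longrightarrow> h \<in> W \<Longrightarrow> act z ` h \<in> W"
begin

sublocale H: subgroup H G by (rule subgroup_H)

definition translate :: "'g \<Rightarrow> 'v set \<Rightarrow> 'v set" where "translate z h = act z ` h"

lemma translate_in_W: "z \<in> H \<Longrightarrow> h \<in> W \<Longrightarrow> translate z h \<in> W"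
  by (simp add: translate_def translate_W)

lemma translate_subset: "z \<in> H \<Longrightarrow> h \<subseteq> V \<Longrightarrow> translate z h \<subseteq> V"
  using act_closed by (auto simp: translate_def)

lemma translate_one: "h \<subseteq> V \<Longrightarrow> translate \<one> h = h"
  using act_one by (force simp: translate_def)

lemma translate_mult: "y \<in> H \<Longrightarrow> z \<in> H \<Longrightarrow> h \<subseteq> V \<Longrightarrow> translate (y \<otimes> z) h = translate y (translate z h)"
  using act_mult by (force simp: translate_def)

lemma translate_inv: "z \<in> H \<Longrightarrow> h \<subseteq> V \<Longrightarrow> translate (inv z) (translate z h) = h"
  using translate_mult[of "inv z" z h] translate_one by simp

lemma translate_mono: "h \<subseteq> k \<Longrightarrow> translate z h \<subseteq> translate z k"
  by (auto simp: translate_def)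

lemma translate_union: "translate z (h \<union> k) = translate z h \<union> translate z k"
  by (auto simp: translate_def)

lemma translate_V: "z \<in> H \<Longrightarrow> translate z V = V"
  using translate_subset[of z V] translate_mono[OF translate_subset[of "inv z" V], of z]
    translate_mult[of z "inv z" V] translate_one by auto

lemma act_inj: "z \<in> H \<Longrightarrow> inj_on (act z) V"
  by (rule inj_on_inverseI[of _ "act (inv z)"]) (simp add: act_mult[symmetric] act_one)

lemma translate_disjoint: "z \<in> H \<Longrightarrow> h \<subseteq> V \<Longrightarrow> k \<subseteq> V \<Longrightarrow> h \<inter> k = {} \<Longrightarrow> translate z h \<inter> translate z k = {}"
  using inj_on_image_Int[OF act_inj, of z h k] by (simp add: translate_def)

lemma translate_cover: "z \<in> H \<Longrightarrow> h \<union> k = V \<Longrightarrow> translate z h \<union> translate z k = V"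
  using translate_union[of z h k] translate_V by simp

lemma translate_compl: "z \<in> H \<Longrightarrow> h \<subseteq> V \<Longrightarrow> translate z (V - h) = V - translate z h"
  using translate_disjoint[of z h "V - h"] translate_cover[of z h "V - h"] translate_subset[of z "V - h"] by auto

section \<open>How an element moves a halfspace\<close>

definition stabilizes :: "'g \<Rightarrow> 'v set \<Rightarrow> bool" where
  "stabilizes x h \<longleftrightarrow> (\<exists>m>0. x [^] (m::nat) \<in> H \<and> translate (x [^] m) h = h)"

text \<open>In the picture of a tree, for an element that neither stabilizes nor skewers
  \<open>h\<close>, its fixed points or axis lie outside \<open>h\<close> if it contracts
  \<open>h\<close> and inside \<open>h\<close> if it expands \<open>h\<close>.\<close>

definition contracts :: "'g \<Rightarrow> 'v set \<Rightarrow> bool" where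
  "contracts x h \<longleftrightarrow> (\<exists>m>0. x [^] (m::nat) \<in> H \<and> translate (x [^] m) h \<inter> h = {})"

definition expands :: "'g \<Rightarrow> 'v set \<Rightarrow> bool" where
  "expands x h \<longleftrightarrow> (\<exists>m>0. x [^] (m::nat) \<in> H \<and> translate (x [^] m) h \<union> h = V)"

definition skewers :: "'g \<Rightarrow> 'v set \<Rightarrow> bool" where
  "skewers x h \<longleftrightarrow> (\<exists>m>0. x [^] (m::nat) \<in> H \<and>
     (translate (x [^] m) h \<subset> h \<or> h \<subset> translate (x [^] m) h))"

text \<open>For the two powers \<open>X\<close> and \<open>Y\<close>, disjointness and covering give
  \<open>X h \<subseteq> V - h \<subseteq> Y h\<close>. Applying \<open>Y\<close> to the first and
  \<open>X\<close> to the second, commutation gives \<open>Y h \<subseteq> X h\<close>. So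
  \<open>X\<close> exchanges \<open>h\<close> with its complement and its square fixes
  \<open>h\<close>. The case \<open>x = y\<close> is used as well.\<close>

lemma commuting_signs:
  assumes x: "x \<in> carrier G" and y: "y \<in> carrier G" and xy: "x \<otimes> y = y \<otimes> x" and h: "h \<in> W"
    and "contracts x h" "expands y h"
  shows "stabilizes x h"
proof -
  obtain m n :: nat where m: "m > 0" "x [^] m \<in> H" "translate (x [^] m) h \<inter> h = {}"
    and n: "n > 0" "y [^] n \<in> H" "translate (y [^] n) h \<union> h = V"
    using assms by (auto simp: contracts_def expands_def)
  let ?X = "translate (x [^] m)" and ?Y = "translate (y [^] n)"
  note hV = subset[OF h]
  have XY: "?X (?Y h) = ?Y (?X h)"
    using translate_mult[OF m(2) n(2) hV] translate_mult[OF n(2) m(2) hV] nat_pow_commute[OF x y xy, of m n] by simp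
  have "?X (?Y h) \<inter> ?Y h = {}"
    using XY translate_disjoint[OF n(2) translate_subset[OF m(2) hV] hV m(3)] by simp
  moreover have "?X (?Y h) \<union> ?X h = V" using translate_cover[OF m(2) n(3)] .
  ultimately have X: "?X h = V - h"
    using m(3) n(3) translate_subset[OF m(2) hV] by blast
  have "?X (?X h) = h"
    using translate_compl[OF m(2) hV] X hV by auto
  then have "translate (x [^] (m + m)) h = h"
    using translate_mult[OF m(2) m(2) hV] x by (simp add: nat_pow_mult)
  moreover have "x [^] (m + m) \<in> H" using m(2) x by (simp flip: nat_pow_mult)
  ultimately show ?thesis unfolding stabilizes_def using m(1) by (intro exI[of _ "m + m"]) auto
qed

text \<open>Any other position of the translate, by nestedness, would stabilize, skew or contract
  \<open>h\<close>; the last is excluded by \<open>commuting_signs\<close> applied to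
  \<open>x\<close> and itself.\<close>

lemma sign_all_powers:
  assumes x: "x \<in> carrier G" and h: "h \<in> W" and "\<not> stabilizes x h" "\<not> skewers x h" "expands x h"
    and m: "m > 0" "x [^] (m::nat) \<in> H"
  shows "translate (x [^] m) h \<union> h = V"
proof -
  have "translate (x [^] m) h \<inter> h \<noteq> {}"
    using commuting_signs[OF x x _ h] assms by (auto simp: contracts_def)
  then show ?thesis
    using nested[OF translate_in_W[OF m(2) h] h] assms(3,4) m by (auto simp: stabilizes_def skewers_def)
qed

lemma sign_cases:
  assumes x: "x \<in> carrier G" and h: "h \<in> W" and "\<not> stabilizes x h" "\<not> skewers x h"
  shows "contracts x h \<longleftrightarrow> \<not> expands x h"
proof
  show "contracts x h \<Longrightarrow> \<not> expands x h" using commuting_signs[OF x x _ h] assms by auto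
  obtain m :: nat where "m > 0" "x [^] m \<in> H" using power_in_H[OF x] by blast
  then show "\<not> expands x h \<Longrightarrow> contracts x h"
    using nested[OF translate_in_W[of "x [^] m"] h, of h] h assms(3,4)
    by (auto simp: stabilizes_def skewers_def expands_def contracts_def)
qed

text \<open>If a power fixes \<open>h\<close>, then \<open>h\<close> misses both \<open>k\<close>
  and the translate of \<open>k\<close>, which together cover \<open>V\<close>. If both halfspaces
  are expanded, the power takes \<open>h\<close> to \<open>k\<close>, and \<open>k\<close> is the
  complement of \<open>h\<close>; then its square fixes \<open>h\<close>.\<close>

lemma expanded_not_disjoint:
  assumes x: "x \<in> carrier G" and h: "h \<in> W" and k: "k \<in> W" and disj: "h \<inter> k = {}"
    and h': "\<not> skewers x h" "stabilizes x h \<or> expands x h"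
    and k': "\<not> skewers x k" "\<not> stabilizes x k" "expands x k"
  shows False
proof (cases "stabilizes x h")
  case True
  then obtain m :: nat where m: "m > 0" "x [^] m \<in> H" "translate (x [^] m) h = h" by (auto simp: stabilizes_def)
  have "translate (x [^] m) k \<union> k = V" using sign_all_powers[OF x k] k' m by blast
  moreover have "h \<inter> translate (x [^] m) k = {}"
    using translate_disjoint[OF m(2) subset[OF h] subset[OF k] disj] m(3) by simp
  ultimately show False using disj nonempty[OF h] subset[OF h] by blast
next
  case False
  obtain m :: nat where m: "m > 0" "x [^] m \<in> H" using power_in_H[OF x] by blast
  let ?X = "translate (x [^] m)"
  have "?X k \<union> k = V" "?X h \<union> h = V" using sign_all_powers[OF x _ _ _ _ m] False h h' k k' by blast+
  moreover have "?X h \<inter> ?X k = {}" by (rule translate_disjoint[OF m(2) subset[OF h] subset[OF k] disj])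
  ultimately have X: "?X h = k"
    using disj subset[OF k] translate_subset[OF m(2) subset[OF h]] by auto
  then have "k = V - h" using \<open>?X h \<union> h = V\<close> disj by auto
  note X = X this
  then have "translate (x [^] (m + m)) h = V - ?X h"
    using translate_mult[OF m(2) m(2) subset[OF h]] translate_compl[OF m(2) subset[OF h]] x by (simp add: nat_pow_mult)
  also have "\<dots> = h" using X subset[OF h] by auto
  finally have "stabilizes x h"
    unfolding stabilizes_def using m x by (intro exI[of _ "m + m"]) (simp flip: nat_pow_mult)
  then show False using False by simp
qed

text \<open>Since \<open>y\<close> commutes with \<open>x\<close>, it permutes the translates of
  \<open>h\<close> along the direction in which \<open>x\<close> shifts. Discreteness forces some
  \<open>y [^] j\<close> to agree on \<open>h\<close> with a power of \<open>x\<close>.\<close>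

lemma skewers_commuting:
  assumes x: "x \<in> carrier G" and y: "y \<in> carrier G" and xy: "x \<otimes> y = y \<otimes> x" and h: "h \<in> W"
    and "skewers x h"
  shows "\<exists>i j. 0 < j \<and> x [^] (i::int) \<otimes> y [^] (j::int) \<in> H \<and> translate (x [^] i \<otimes> y [^] j) h = h"
proof -
  obtain m :: nat where m: "m > 0" "x [^] m \<in> H" "translate (x [^] m) h \<subset> h \<or> h \<subset> translate (x [^] m) h"
    using assms by (auto simp: skewers_def)
  note hV = subset[OF h]
  \<comment> \<open>A negative exponent is allowed, so that the shift can be taken into
    \<open>h\<close>.\<close>
  have "\<exists>p::int. x [^] p \<in> H \<and> translate (x [^] p) h \<subset> h"
    using m(3)
  proof
    assume "translate (x [^] m) h \<subset> h"
    then show ?thesis using m by (intro exI[of _ "int m"]) (simp add: int_pow_int)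
  next
    assume *: "h \<subset> translate (x [^] m) h"
    have inv: "x [^] (- int m) = inv (x [^] m)" using x by (simp add: int_pow_neg_int)
    have "translate (inv (x [^] m)) h \<subseteq> h"
      using translate_mono[of h "translate (x [^] m) h" "inv (x [^] m)"] * translate_inv[OF m(2) hV] by auto
    moreover have "translate (inv (x [^] m)) h \<noteq> h"
      using * translate_inv[of "inv (x [^] m)" h] m x hV by auto
    ultimately show ?thesis using m inv by (intro exI[of _ "- int m"]) auto
  qed
  then obtain p :: int where p: "x [^] p \<in> H" "translate (x [^] p) h \<subset> h" by blast
  obtain n :: nat where n: "n > 0" "y [^] n \<in> H" using power_in_H[OF y] by blast
  \<comment> \<open>Exponents that are multiples of \<open>p\<close> and of \<open>n\<close> keep
    all these products in \<open>H\<close>.\<close>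
  define e where "e i j = x [^] (p * i) \<otimes> y [^] (int n * j)" for i j :: int
  have eH: "e i j \<in> H" for i j
    unfolding e_def using subgroup_int_pow_closed[OF subgroup_H p(1), of i] subgroup_int_pow_closed[OF subgroup_H n(2), of j] x y
    by (simp add: int_pow_pow int_pow_int[symmetric, of G y n] mult.commute)
  have e_mult: "e (i + a) (j + b) = e a b \<otimes> e i j" for i j a b
  proof -
    have "e a b \<otimes> e i j = x [^] (p * a) \<otimes> (y [^] (int n * b) \<otimes> x [^] (p * i)) \<otimes> y [^] (int n * j)"
      unfolding e_def using x y by (simp add: m_assoc)
    also have "\<dots> = x [^] (p * a) \<otimes> (x [^] (p * i) \<otimes> y [^] (int n * b)) \<otimes> y [^] (int n * j)"
      using int_pow_commute[OF x y xy] by simp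
    also have "\<dots> = (x [^] (p * a) \<otimes> x [^] (p * i)) \<otimes> (y [^] (int n * b) \<otimes> y [^] (int n * j))"
      using x y by (simp add: m_assoc)
    also have "\<dots> = e (i + a) (j + b)"
      unfolding e_def using x y by (simp add: int_pow_mult[symmetric] algebra_simps)
    finally show ?thesis ..
  qed
  define u where "u i j = translate (e i j) h" for i j
  have u_shift: "u (i + a) (j + b) = translate (e a b) (u i j)" for i j a b
    unfolding u_def e_mult by (rule translate_mult[OF eH eH hV])
  have u0: "u 0 0 = h" using translate_one[OF hV] by (simp add: u_def e_def)
  have "\<exists>i j. 0 < j \<and> u i j = u 0 0"
  proof (rule commuting_translates_recur)
    show uW: "u i j \<in> W" for i j using eH h by (simp add: u_def translate_in_W)
    show "u i j \<subseteq> u i' j' \<Longrightarrow> u (i + a) (j + b) \<subseteq> u (i' + a) (j' + b)" for i j i' j' a b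
      unfolding u_shift by (rule translate_mono)
    show "u i j \<inter> u i' j' = {} \<Longrightarrow> u (i + a) (j + b) \<inter> u (i' + a) (j' + b) = {}" for i j i' j' a b
      unfolding u_shift by (rule translate_disjoint[OF eH subset[OF uW] subset[OF uW]])
    show "u i j \<union> u i' j' = V \<Longrightarrow> u (i + a) (j + b) \<union> u (i' + a) (j' + b) = V" for i j i' j' a b
      unfolding u_shift by (rule translate_cover[OF eH])
    have "u 1 0 = translate (x [^] p) h" using x by (simp add: u_def e_def)
    then show "u 1 0 \<subset> u 0 0" using p(2) u0 by simp
  qed
  then obtain i j where "0 < j" "u i j = h" using u0 by auto
  then show ?thesis using n eH[of i j] unfolding u_def e_def
    by (intro exI[of _ "p * i"] exI[of _ "int n * j"]) simp
qed

lemma compl_signs: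
  assumes "h \<in> W" "x \<in> carrier G"
  shows stabilizes_compl: "stabilizes x (V - h) \<longleftrightarrow> stabilizes x h"
    and expands_compl: "expands x (V - h) \<longleftrightarrow> contracts x h"
proof -
  have c: "translate z (V - h) = V - translate z h" "translate z h \<subseteq> V" "h \<subseteq> V" if "z \<in> H" for z
    using translate_compl[OF that subset[OF assms(1)]] translate_subset[OF that] subset[OF assms(1)] by auto
  have "translate z (V - h) = V - h \<longleftrightarrow> translate z h = h" if "z \<in> H" for z
    using c[OF that] by blast
  then show "stabilizes x (V - h) \<longleftrightarrow> stabilizes x h" by (auto simp: stabilizes_def)
  have "translate z (V - h) \<union> (V - h) = V \<longleftrightarrow> translate z h \<inter> h = {}" if "z \<in> H" for z
    using c[OF that] by blast
  then show "expands x (V - h) \<longleftrightarrow> contracts x h" by (auto simp: expands_def contracts_def)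
qed

lemma conjugate_signs:
  assumes "h \<in> W" and x: "x \<in> carrier G" and k: "k \<in> H"
  shows stabilizes_conjugate: "stabilizes (k \<otimes> x \<otimes> inv k) (translate k h) \<longleftrightarrow> stabilizes x h"
    and expands_conjugate: "expands (k \<otimes> x \<otimes> inv k) (translate k h) \<longleftrightarrow> expands x h"
proof -
  note hV = subset[OF assms(1)]
  have pow: "(k \<otimes> x \<otimes> inv k) [^] m = k \<otimes> x [^] m \<otimes> inv k" for m :: nat
    using nat_pow_conjugate[OF _ x] k by simp
  have mem: "k \<otimes> x [^] m \<otimes> inv k \<in> H \<longleftrightarrow> x [^] m \<in> H" for m :: nat
  proof
    assume "k \<otimes> x [^] m \<otimes> inv k \<in> H"
    then have "inv k \<otimes> (k \<otimes> x [^] m \<otimes> inv k) \<otimes> k \<in> H" using k by simp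
    moreover have "inv k \<otimes> (k \<otimes> x [^] m \<otimes> inv k) \<otimes> k = x [^] m"
      using k x by (simp add: m_assoc inv_solve_left')
    ultimately show "x [^] m \<in> H" by simp
  qed (use k in simp)
  have tr: "translate (k \<otimes> x [^] m \<otimes> inv k) (translate k h) = translate k (translate (x [^] m) h)"
    if m: "x [^] m \<in> H" for m :: nat
    using m k translate_mult[of "k \<otimes> x [^] m" "inv k"] translate_mult[of k "x [^] m" h]
      translate_subset[OF k hV] hV translate_inv[OF k hV] by simp
  have inj: "translate k h1 = translate k h2 \<longleftrightarrow> h1 = h2" if "h1 \<subseteq> V" "h2 \<subseteq> V" for h1 h2
    using translate_inv[OF k] that by metis
  have "translate k (translate (x [^] m) h) = translate k h \<longleftrightarrow> translate (x [^] m) h = h"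
    if "x [^] m \<in> H" for m :: nat using inj translate_subset[OF that hV] hV by blast
  then show "stabilizes (k \<otimes> x \<otimes> inv k) (translate k h) \<longleftrightarrow> stabilizes x h"
    unfolding stabilizes_def pow mem using tr by auto
  have cover: "translate k (translate (x [^] m) h) \<union> translate k h = V \<longleftrightarrow> translate (x [^] m) h \<union> h = V"
    if "x [^] m \<in> H" for m :: nat
    using inj[of "translate (x [^] m) h \<union> h" V] translate_subset[OF that hV] hV translate_V[OF k]
    by (simp add: translate_union)
  then show "expands (k \<otimes> x \<otimes> inv k) (translate k h) \<longleftrightarrow> expands x h"
    unfolding expands_def pow mem by (intro ex_cong1 conj_cong refl) (simp_all add: tr cover)
qed

end


section \<open>Virtual actions of right-angled Artin groups without small separating cliques\<close>

text \<open>The assumption \<open>gen_invariant\<close> says that the \<open>gen v\<close> generate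
  \<open>G\<close>, in the form in which it is applied. The maps \<open>\<epsilon> k\<close> make
  every wall stabilizer embed into a free abelian group of rank at most \<open>n\<close>, and the
  exponent sums \<open>\<chi> v\<close> are dual to the generators.\<close>

locale raag_virtual_action = virtual_action G V W H act + graph \<Gamma>
  for G :: "('g, 'm) monoid_scheme" (structure) and V :: "'v set" and W :: "'v set set"
    and H :: "'g set" and act :: "'g \<Rightarrow> 'v \<Rightarrow> 'v" and \<Gamma> :: "('a, 'b) pre_digraph" +
  fixes gen :: "'a \<Rightarrow> 'g" and \<chi> :: "'a \<Rightarrow> 'g \<Rightarrow> int" and n :: nat
    and K :: "'k set" and \<epsilon> :: "'k \<Rightarrow> 'g \<Rightarrow> int"
  assumes gen_closed: "v \<in> verts \<Gamma> \<Longrightarrow> gen v \<in> carrier G"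
    and gen_commute: "u \<rightarrow>\<^bsub>\<Gamma>\<^esub> v \<Longrightarrow> gen u \<otimes> gen v = gen v \<otimes> gen u"
    and gen_powers_noncommuting: "u \<in> verts \<Gamma> \<Longrightarrow> v \<in> verts \<Gamma> \<Longrightarrow> u \<noteq> v \<Longrightarrow> \<not> u \<rightarrow>\<^bsub>\<Gamma>\<^esub> v \<Longrightarrow>
      0 < i \<Longrightarrow> 0 < j \<Longrightarrow> gen u [^] (i::nat) \<otimes> gen v [^] (j::nat) \<noteq> gen v [^] j \<otimes> gen u [^] i"
    and \<chi>_mult: "v \<in> verts \<Gamma> \<Longrightarrow> x \<in> carrier G \<Longrightarrow> y \<in> carrier G \<Longrightarrow> \<chi> v (x \<otimes> y) = \<chi> v x + \<chi> v y"
    and \<chi>_gen: "u \<in> verts \<Gamma> \<Longrightarrow> v \<in> verts \<Gamma> \<Longrightarrow> \<chi> v (gen u) = (if u = v then 1 else 0)"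
    and gen_invariant: "(\<And>g v. g \<in> carrier G \<Longrightarrow> v \<in> verts \<Gamma> \<Longrightarrow> (P (g \<otimes> gen v) :: bool) = P g) \<Longrightarrow>
      g \<in> carrier G \<Longrightarrow> P g = P \<one>"
    and no_separating_clique: "l \<le> n \<Longrightarrow> \<not> has_separating_clique l \<Gamma>"
    and not_complete: "\<not> clique_on \<Gamma> (verts \<Gamma>)"
    and finite_K: "finite K" and card_K: "card K \<le> n"
    and \<epsilon>_mult: "k \<in> K \<Longrightarrow> x \<in> H \<Longrightarrow> y \<in> H \<Longrightarrow> \<epsilon> k (x \<otimes> y) = \<epsilon> k x + \<epsilon> k y"
    and \<epsilon>_eq_0: "x \<in> H \<Longrightarrow> h \<in> W \<Longrightarrow> translate x h = h \<Longrightarrow> \<forall>k\<in>K. \<epsilon> k x = 0 \<Longrightarrow> x = \<one>"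
begin

section \<open>Stabilizers of halfspaces and conjugates of generators\<close>

definition stabilizer :: "'v set \<Rightarrow> 'g set" where
  "stabilizer h = {x \<in> H. translate x h = h}"

definition gconj :: "'g \<Rightarrow> 'a \<Rightarrow> 'g" where
  "gconj g v = g \<otimes> gen v \<otimes> inv g"

definition stable_verts :: "'g \<Rightarrow> 'v set \<Rightarrow> 'a set" where
  "stable_verts g h = {v \<in> verts \<Gamma>. stabilizes (gconj g v) h}"

lemma adj_closed: "u \<rightarrow>\<^bsub>\<Gamma>\<^esub> v \<Longrightarrow> u \<in> verts \<Gamma>" "u \<rightarrow>\<^bsub>\<Gamma>\<^esub> v \<Longrightarrow> v \<in> verts \<Gamma>"
  using adj_in_verts by blast+

lemma conj_closed: "g \<in> carrier G \<Longrightarrow> v \<in> verts \<Gamma> \<Longrightarrow> gconj g v \<in> carrier G"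
  by (simp add: gconj_def gen_closed)

lemma conj_mult:
  "g \<in> carrier G \<Longrightarrow> a \<in> carrier G \<Longrightarrow> b \<in> carrier G \<Longrightarrow>
     (g \<otimes> a \<otimes> inv g) \<otimes> (g \<otimes> b \<otimes> inv g) = g \<otimes> (a \<otimes> b) \<otimes> inv g"
  by (simp add: m_assoc inv_solve_left')

lemma conj_commute:
  assumes "g \<in> carrier G" "u \<rightarrow>\<^bsub>\<Gamma>\<^esub> v"
  shows "gconj g u \<otimes> gconj g v = gconj g v \<otimes> gconj g u"
  using conj_mult[OF assms(1)] gen_closed adj_closed[OF assms(2)] gen_commute[OF assms(2)]
  by (simp add: gconj_def)

lemma conj_pow: "g \<in> carrier G \<Longrightarrow> v \<in> verts \<Gamma> \<Longrightarrow> gconj g v [^] (m::nat) = g \<otimes> gen v [^] m \<otimes> inv g"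
  by (simp add: gconj_def nat_pow_conjugate gen_closed)

lemma conj_powers_noncommuting:
  assumes "g \<in> carrier G" "u \<in> verts \<Gamma>" "v \<in> verts \<Gamma>" "u \<noteq> v" "\<not> u \<rightarrow>\<^bsub>\<Gamma>\<^esub> v" "0 < i" "0 < j"
  shows "gconj g u [^] (i::int) \<otimes> gconj g v [^] (j::int) \<noteq> gconj g v [^] j \<otimes> gconj g u [^] i"
proof
  obtain a b where ab: "i = int a" "j = int b" "0 < a" "0 < b" using assms(6,7) pos_int_cases by metis
  assume "gconj g u [^] i \<otimes> gconj g v [^] j = gconj g v [^] j \<otimes> gconj g u [^] i"
  then have "g \<otimes> (gen u [^] a \<otimes> gen v [^] b) \<otimes> inv g = g \<otimes> (gen v [^] b \<otimes> gen u [^] a) \<otimes> inv g"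
    using assms gen_closed by (simp add: ab int_pow_int conj_pow conj_mult)
  then have "gen u [^] a \<otimes> gen v [^] b = gen v [^] b \<otimes> gen u [^] a"
    using assms gen_closed by simp
  then show False using gen_powers_noncommuting assms ab by blast
qed

lemma \<chi>_int_pow: "v \<in> verts \<Gamma> \<Longrightarrow> x \<in> carrier G \<Longrightarrow> \<chi> v (x [^] (i::int)) = i * \<chi> v x"
  by (rule additive_int_pow[OF subgroup_self]) (auto simp: \<chi>_mult)

lemma \<chi>_conj:
  assumes "g \<in> carrier G" "u \<in> verts \<Gamma>" "v \<in> verts \<Gamma>"
  shows "\<chi> v (gconj g u) = (if u = v then 1 else 0)"
proof -
  have "\<chi> v \<one> = 0" using \<chi>_mult[of v \<one> \<one>] assms by simp
  then have "\<chi> v g + \<chi> v (inv g) = 0" using \<chi>_mult[of v g "inv g"] assms by simp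
  then show ?thesis using assms by (simp add: gconj_def \<chi>_mult gen_closed \<chi>_gen)
qed

lemma subgroup_stabilizer:
  assumes "h \<in> W"
  shows "subgroup (stabilizer h) G"
proof (rule subgroupI)
  note hV = subset[OF assms]
  show "stabilizer h \<noteq> {}" using translate_one[OF hV] H.one_closed unfolding stabilizer_def by blast
  show "inv a \<in> stabilizer h" if "a \<in> stabilizer h" for a
    using that translate_inv[of a h] hV by (auto simp: stabilizer_def)
  show "a \<otimes> b \<in> stabilizer h" if "a \<in> stabilizer h" "b \<in> stabilizer h" for a b
    using that translate_mult[of a b h] hV by (auto simp: stabilizer_def)
qed (auto simp: stabilizer_def)

text \<open>The commutator stabilizes \<open>h\<close> and is killed by every
  \<open>\<epsilon> k\<close>, hence is trivial.\<close>

lemma stabilizer_commute: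
  assumes h: "h \<in> W" and x: "x \<in> stabilizer h" and y: "y \<in> stabilizer h"
  shows "x \<otimes> y = y \<otimes> x"
proof -
  interpret S: subgroup "stabilizer h" G using h by (rule subgroup_stabilizer)
  let ?c = "x \<otimes> y \<otimes> inv (y \<otimes> x)"
  have c: "?c \<in> stabilizer h" using x y by blast
  have H: "x \<in> H" "y \<in> H" "?c \<in> H" using x y c by (auto simp: stabilizer_def)
  have eq: "?c \<otimes> (y \<otimes> x) = x \<otimes> y" using H by (simp add: m_assoc)
  have "\<epsilon> k ?c = 0" if "k \<in> K" for k
    using \<epsilon>_mult[OF that H(3), of "y \<otimes> x"] \<epsilon>_mult[OF that] H unfolding eq by simp
  then have "?c = \<one>" using \<epsilon>_eq_0[OF H(3) h] c by (simp add: stabilizer_def)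
  then show ?thesis using eq H by simp
qed

lemma independent_stabilizer_card:
  assumes "h \<in> W" "S \<subseteq> verts \<Gamma>" "\<And>s. s \<in> S \<Longrightarrow> z s \<in> stabilizer h"
    "\<And>s t. s \<in> S \<Longrightarrow> t \<in> S \<Longrightarrow> \<chi> s (z t) \<noteq> 0 \<longleftrightarrow> s = t"
  shows "card S \<le> n"
proof -
  have "card S \<le> card K"
  proof (rule independent_card_le[OF finite_K subgroup_stabilizer[OF assms(1)]])
    show "finite S" using assms(2) finite_verts finite_subset by blast
    show "\<epsilon> k (x \<otimes> y) = \<epsilon> k x + \<epsilon> k y" if "k \<in> K" "x \<in> stabilizer h" "y \<in> stabilizer h" for k x y
      using that \<epsilon>_mult by (simp add: stabilizer_def)
    show "x = \<one>" if "x \<in> stabilizer h" "\<forall>k\<in>K. \<epsilon> k x = 0" for x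
      using that \<epsilon>_eq_0 assms(1) by (simp add: stabilizer_def)
    show "\<chi> s (x \<otimes> y) = \<chi> s x + \<chi> s y" if "s \<in> S" "x \<in> stabilizer h" "y \<in> stabilizer h" for s x y
      using that assms(2) \<chi>_mult[of s x y] by (auto simp: stabilizer_def)
  qed (use assms in auto)
  then show ?thesis using card_K by simp
qed

lemma closed_set_eq_complement_of_clique:
  assumes "clique_on \<Gamma> S" "card S \<le> n" "T \<subseteq> verts \<Gamma> - S" "T \<noteq> {}"
    and "\<And>v w. v \<in> T \<Longrightarrow> w \<in> verts \<Gamma> - S \<Longrightarrow> v \<rightarrow>\<^bsub>\<Gamma>\<^esub> w \<Longrightarrow> w \<in> T"
  shows "T = verts \<Gamma> - S"
proof (rule ccontr)
  assume "T \<noteq> verts \<Gamma> - S"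
  then have "T \<subset> verts \<Gamma> - S" using assms(3) by simp
  moreover have "\<forall>v\<in>T. \<forall>w \<in> verts \<Gamma> - S. v \<rightarrow>\<^bsub>\<Gamma>\<^esub> w \<longrightarrow> w \<in> T" using assms(5) by blast
  ultimately have "has_separating_clique (card S) \<Gamma>"
    using assms(1,4) has_separating_clique_iff[OF graph_axioms] by blast
  then show False using no_separating_clique assms(2) by blast
qed

text \<open>No vertex outside the link is adjacent to \<open>v\<close>, so without small separating
  cliques \<open>v\<close> is the only vertex outside it. Then \<open>v\<close> is adjacent to all
  other vertices and \<open>\<Gamma>\<close> is complete.\<close>

lemma link_not_small_clique:
  assumes "v \<in> verts \<Gamma>" "clique_on \<Gamma> {w. v \<rightarrow>\<^bsub>\<Gamma>\<^esub> w}" "card {w. v \<rightarrow>\<^bsub>\<Gamma>\<^esub> w} \<le> n"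
  shows False
proof -
  have "{v} = verts \<Gamma> - {w. v \<rightarrow>\<^bsub>\<Gamma>\<^esub> w}"
    by (rule closed_set_eq_complement_of_clique) (use assms adj_not_same in auto)
  then have "v \<rightarrow>\<^bsub>\<Gamma>\<^esub> w" if "w \<in> verts \<Gamma>" "w \<noteq> v" for w using that by blast
  moreover have "w \<rightarrow>\<^bsub>\<Gamma>\<^esub> v" if "v \<rightarrow>\<^bsub>\<Gamma>\<^esub> w" for w using graph_symmetric[OF that] .
  ultimately have "clique_on \<Gamma> (verts \<Gamma>)"
    using assms(2) unfolding clique_on_def by blast
  then show False using not_complete by simp
qed

text \<open>Powers in the abelian stabilizer commute, which powers of nonadjacent generators never
  do. The exponent sums show these powers to be independent, so their number is at most the
  rank.\<close>

lemma stable_verts_clique: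
  assumes h: "h \<in> W" and g: "g \<in> carrier G"
  shows "clique_on \<Gamma> (stable_verts g h)" "card (stable_verts g h) \<le> n"
proof -
  have "\<exists>m::nat. m > 0 \<and> gconj g v [^] int m \<in> stabilizer h" if "v \<in> stable_verts g h" for v
    using that by (auto simp: stable_verts_def stabilizes_def stabilizer_def int_pow_int)
  then obtain m :: "'a \<Rightarrow> nat" where m: "\<And>v. v \<in> stable_verts g h \<Longrightarrow> m v > 0"
    "\<And>v. v \<in> stable_verts g h \<Longrightarrow> gconj g v [^] int (m v) \<in> stabilizer h" by metis
  have sub: "stable_verts g h \<subseteq> verts \<Gamma>" by (auto simp: stable_verts_def)
  have "u \<rightarrow>\<^bsub>\<Gamma>\<^esub> v" if "u \<in> stable_verts g h" "v \<in> stable_verts g h" "u \<noteq> v" for u v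
  proof (rule ccontr)
    assume "\<not> u \<rightarrow>\<^bsub>\<Gamma>\<^esub> v"
    then show False
      using conj_powers_noncommuting[OF g, of u v "int (m u)" "int (m v)"] that m sub
        stabilizer_commute[OF h m(2)[OF that(1)] m(2)[OF that(2)]] by auto
  qed
  then show "clique_on \<Gamma> (stable_verts g h)" using sub by (auto simp: clique_on_def)
  show "card (stable_verts g h) \<le> n"
  proof (rule independent_stabilizer_card[OF h sub m(2)])
    fix s t assume "s \<in> stable_verts g h" "t \<in> stable_verts g h"
    then have "s \<in> verts \<Gamma>" "t \<in> verts \<Gamma>" "m t > 0" using sub m(1) by auto
    then show "\<chi> s (gconj g t [^] int (m t)) \<noteq> 0 \<longleftrightarrow> s = t"
      using \<chi>_int_pow[of s "gconj g t"] conj_closed[OF g, of t] \<chi>_conj[OF g, of t s] by simp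
  qed
qed

text \<open>Every \<open>w\<close> in the link of \<open>v\<close> yields a product of a power of
  \<open>?x\<close> and a positive power of \<open>gconj g w\<close> that stabilizes
  \<open>h\<close>. Such products commute, and \<open>?x\<close> commutes with everything involved,
  so the powers of the \<open>gconj g w\<close> commute too. The link is thus a clique, and exponent
  sums bound its size by \<open>n\<close>.\<close>

lemma not_skewers:
  assumes h: "h \<in> W" and g: "g \<in> carrier G" and v: "v \<in> verts \<Gamma>"
  shows "\<not> skewers (gconj g v) h"
proof
  assume skew: "skewers (gconj g v) h"
  let ?x = "gconj g v" and ?L = "{w. v \<rightarrow>\<^bsub>\<Gamma>\<^esub> w}"
  note x = conj_closed[OF g v]
  have sub: "?L \<subseteq> verts \<Gamma>" using adj_closed by blast
  have "\<exists>i j. 0 < j \<and> ?x [^] (i::int) \<otimes> gconj g w [^] (j::int) \<in> stabilizer h" if "w \<in> ?L" for w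
    using skewers_commuting[OF x conj_closed[OF g, of w] conj_commute[OF g, of v w] h skew] that sub
    by (auto simp: stabilizer_def)
  then obtain i j :: "'a \<Rightarrow> int" where j: "\<And>w. w \<in> ?L \<Longrightarrow> 0 < j w"
    and z: "\<And>w. w \<in> ?L \<Longrightarrow> ?x [^] i w \<otimes> gconj g w [^] j w \<in> stabilizer h" by metis
  have "u \<rightarrow>\<^bsub>\<Gamma>\<^esub> w" if uw: "u \<in> ?L" "w \<in> ?L" "u \<noteq> w" for u w
  proof (rule ccontr)
    assume na: "\<not> u \<rightarrow>\<^bsub>\<Gamma>\<^esub> w"
    define a a' b b' where ab: "a = ?x [^] i u" "a' = ?x [^] i w" "b = gconj g u [^] j u" "b' = gconj g w [^] j w"
    have cl: "a \<in> carrier G" "a' \<in> carrier G" "b \<in> carrier G" "b' \<in> carrier G"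
      using ab x conj_closed[OF g] uw sub by auto
    have comm: "a \<otimes> a' = a' \<otimes> a" "a \<otimes> b' = b' \<otimes> a" "a' \<otimes> b = b \<otimes> a'"
      unfolding ab using int_pow_commute[OF x x] int_pow_commute[OF x conj_closed[OF g] conj_commute[OF g]] uw sub by auto
    have "a \<otimes> a' \<otimes> (b \<otimes> b') = a \<otimes> (a' \<otimes> b) \<otimes> b'" using cl by (simp add: m_assoc)
    also have "\<dots> = (a \<otimes> b) \<otimes> (a' \<otimes> b')" unfolding comm using cl by (simp add: m_assoc)
    also have "\<dots> = (a' \<otimes> b') \<otimes> (a \<otimes> b)"
      using stabilizer_commute[OF h z[OF uw(1)] z[OF uw(2)]] by (simp add: ab)
    also have "\<dots> = a' \<otimes> (b' \<otimes> a) \<otimes> b" using cl by (simp add: m_assoc)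
    also have "\<dots> = (a' \<otimes> a) \<otimes> (b' \<otimes> b)" unfolding comm(2)[symmetric] using cl by (simp add: m_assoc)
    also have "\<dots> = a \<otimes> a' \<otimes> (b' \<otimes> b)" by (simp add: comm)
    finally have "b \<otimes> b' = b' \<otimes> b" using cl by simp
    then show False
      using conj_powers_noncommuting[OF g _ _ uw(3) na j[OF uw(1)] j[OF uw(2)]] uw sub by (auto simp: ab)
  qed
  then have "clique_on \<Gamma> ?L" using sub by (auto simp: clique_on_def)
  moreover have "card ?L \<le> n"
  proof (rule independent_stabilizer_card[OF h sub z])
    fix s t assume st: "s \<in> ?L" "t \<in> ?L"
    \<comment> \<open>Without loops \<open>s \<noteq> v\<close>, so the power of \<open>?x\<close>
      contributes nothing to \<open>\<chi> s\<close>.\<close>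
    then have V: "s \<in> verts \<Gamma>" "t \<in> verts \<Gamma>" "s \<noteq> v" using sub adj_not_same by auto
    then show "\<chi> s (?x [^] i t \<otimes> gconj g t [^] j t) \<noteq> 0 \<longleftrightarrow> s = t"
      using j[OF st(2)] x conj_closed[OF g, of t] \<chi>_conj[OF g] v by (simp add: \<chi>_mult \<chi>_int_pow)
  qed
  ultimately show False using link_not_small_clique[OF v] by simp
qed

section \<open>The chosen side of a halfspace\<close>

definition positive :: "'g \<Rightarrow> 'v set \<Rightarrow> bool" where
  "positive g h \<longleftrightarrow> (\<exists>v \<in> verts \<Gamma> - stable_verts g h. expands (gconj g v) h)"

text \<open>Adjacent unstable vertices have the same sign by \<open>commuting_signs\<close>. So the
  vertices with the sign of \<open>u\<close> form a closed set in the complement of the small clique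
  \<open>?S\<close>, which \<open>?S\<close> cannot separate.\<close>

lemma expands_constant:
  assumes h: "h \<in> W" and g: "g \<in> carrier G" and u: "u \<in> verts \<Gamma> - stable_verts g h"
    and v: "v \<in> verts \<Gamma> - stable_verts g h"
  shows "expands (gconj g u) h \<longleftrightarrow> expands (gconj g v) h"
proof -
  let ?S = "stable_verts g h"
  let ?T = "{w \<in> verts \<Gamma> - ?S. expands (gconj g w) h \<longleftrightarrow> expands (gconj g u) h}"
  have adj: "expands (gconj g w) h" if w: "w \<in> verts \<Gamma> - ?S" "w' \<in> verts \<Gamma> - ?S" "w \<rightarrow>\<^bsub>\<Gamma>\<^esub> w'" "expands (gconj g w') h" for w w'
  proof (rule ccontr)
    assume "\<not> expands (gconj g w) h"
    then have "contracts (gconj g w) h"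
      using sign_cases[OF conj_closed[OF g] h, of w] w not_skewers[OF h g] by (auto simp: stable_verts_def)
    then have "stabilizes (gconj g w) h"
      using commuting_signs[OF conj_closed[OF g] conj_closed[OF g] conj_commute[OF g w(3)] h] w by auto
    then show False using w by (simp add: stable_verts_def)
  qed
  have "?T = verts \<Gamma> - ?S"
  proof (rule closed_set_eq_complement_of_clique)
    fix w w' assume "w \<in> ?T" "w' \<in> verts \<Gamma> - ?S" "w \<rightarrow>\<^bsub>\<Gamma>\<^esub> w'"
    then show "w' \<in> ?T" using adj[of w w'] adj[of w' w] graph_symmetric[of w w'] by blast
  qed (use stable_verts_clique[OF h g] u in auto)
  then show ?thesis using v by blast
qed

lemma positive_iff:
  assumes "h \<in> W" "g \<in> carrier G" "v \<in> verts \<Gamma> - stable_verts g h"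
  shows "positive g h \<longleftrightarrow> expands (gconj g v) h"
  using expands_constant[OF assms(1,2) _ assms(3)] assms(3) unfolding positive_def by blast

text \<open>Passing from \<open>g\<close> to \<open>g \<otimes> gen u\<close> changes nothing if the
  sign is read at an unstable neighbour \<open>v\<close> of \<open>u\<close>, as
  \<open>gen u\<close> commutes with \<open>gen v\<close>. Such a \<open>v\<close> exists because
  the link of \<open>u\<close> is not a small clique, and so is not contained in one.\<close>

lemma positive_eq:
  assumes h: "h \<in> W" and g: "g \<in> carrier G"
  shows "positive g h \<longleftrightarrow> positive \<one> h"
proof (rule gen_invariant[OF _ g])
  fix g u assume g: "g \<in> carrier G" and u: "u \<in> verts \<Gamma>"
  let ?L = "{w. u \<rightarrow>\<^bsub>\<Gamma>\<^esub> w}" and ?S = "stable_verts g h"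
  have "\<not> ?L \<subseteq> ?S"
  proof
    assume L: "?L \<subseteq> ?S"
    have "finite ?S" using finite_verts by (simp add: stable_verts_def)
    then have "card ?L \<le> n" using card_mono[OF _ L] stable_verts_clique(2)[OF h g] by simp
    moreover have "clique_on \<Gamma> ?L"
      using stable_verts_clique(1)[OF h g] L unfolding clique_on_def by blast
    ultimately show False using link_not_small_clique[OF u] by simp
  qed
  then obtain v where v: "u \<rightarrow>\<^bsub>\<Gamma>\<^esub> v" "v \<notin> ?S" by blast
  note V = adj_closed[OF v(1)]
  have "gconj (g \<otimes> gen u) v = g \<otimes> (gen u \<otimes> gen v \<otimes> inv (gen u)) \<otimes> inv g"
    using g gen_closed[OF V(1)] gen_closed[OF V(2)] by (simp add: gconj_def inv_mult_group m_assoc)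
  also have "gen u \<otimes> gen v \<otimes> inv (gen u) = gen v"
    unfolding gen_commute[OF v(1)] using gen_closed[OF V(1)] gen_closed[OF V(2)] by (simp add: m_assoc)
  finally have c: "gconj (g \<otimes> gen u) v = gconj g v" by (simp add: gconj_def)
  then have "v \<notin> stable_verts (g \<otimes> gen u) h" using v V by (simp add: stable_verts_def)
  then show "positive (g \<otimes> gen u) h = positive g h"
    using positive_iff[OF h] g gen_closed[OF u] v V c by simp
qed

lemma exists_unstable:
  assumes "h \<in> W" "g \<in> carrier G"
  shows "\<exists>v. v \<in> verts \<Gamma> - stable_verts g h"
proof (rule ccontr)
  assume "\<not> ?thesis"
  then have "stable_verts g h = verts \<Gamma>" by (auto simp: stable_verts_def)
  then show False using stable_verts_clique(1)[OF assms] not_complete by simp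
qed

text \<open>Conjugation by \<open>k\<close> turns the sign of \<open>h\<close> at
  \<open>\<one>\<close> into the sign of the translate at \<open>k\<close>, which
  \<open>positive_eq\<close> compares with the one at \<open>\<one>\<close>.\<close>

lemma positive_translate:
  assumes h: "h \<in> W" and k: "k \<in> H"
  shows "positive \<one> (translate k h) \<longleftrightarrow> positive \<one> h"
proof -
  have kc: "k \<in> carrier G" using k by simp
  obtain v where v: "v \<in> verts \<Gamma> - stable_verts \<one> h" using exists_unstable[OF h] by blast
  have c: "gconj k v = k \<otimes> gconj \<one> v \<otimes> inv k" "gconj \<one> v \<in> carrier G"
    using v gen_closed[of v] by (auto simp: gconj_def)
  have "v \<in> verts \<Gamma> - stable_verts k (translate k h)"
    using v stabilizes_conjugate[OF h c(2) k] c(1) by (simp add: stable_verts_def)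
  then show ?thesis
    using positive_iff[OF h _ v] positive_iff[OF translate_in_W[OF k h] kc]
      positive_eq[OF translate_in_W[OF k h] kc] expands_conjugate[OF h c(2) k] c(1) by simp
qed

text \<open>A vertex unstable for the translate expands it and stabilizes or expands
  \<open>h\<close>, which \<open>expanded_not_disjoint\<close> forbids for disjoint
  halfspaces.\<close>

lemma positive_not_disjoint:
  assumes h: "h \<in> W" and k: "k \<in> H" and "positive \<one> h"
  shows "h \<inter> translate k h \<noteq> {}"
proof
  assume disj: "h \<inter> translate k h = {}"
  note k' = translate_in_W[OF k h]
  obtain v where v: "v \<in> verts \<Gamma> - stable_verts \<one> (translate k h)" using exists_unstable[OF k'] by blast
  have "positive \<one> (translate k h)" using positive_translate[OF h k] assms(3) by simp
  then have "expands (gconj \<one> v) (translate k h)" using positive_iff[OF k' _ v] by simp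
  moreover have "stabilizes (gconj \<one> v) h \<or> expands (gconj \<one> v) h"
    using positive_iff[OF h, of \<one> v] assms(3) v by (auto simp: stable_verts_def)
  ultimately show False
    using expanded_not_disjoint[OF conj_closed h k' disj] not_skewers[OF h] not_skewers[OF k'] v
    by (auto simp: stable_verts_def)
qed

text \<open>At an unstable vertex either \<open>h\<close> or its complement is expanded, so one of
  them is positive. The translate by \<open>k\<close> rules out the first and that by
  \<open>k'\<close> the second.\<close>

theorem no_ping_pong:
  assumes h: "h \<in> W" and "k \<in> H" "h \<inter> translate k h = {}" and "k' \<in> H" "h \<union> translate k' h = V"
  shows False
proof -
  have h': "V - h \<in> W" using h by (rule compl)
  have "translate k' (V - h) = V - translate k' h"
    using translate_compl[OF assms(4) subset[OF h]] .
  then have "(V - h) \<inter> translate k' (V - h) = {}" using assms(5) by blast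
  then have "\<not> positive \<one> (V - h)" using positive_not_disjoint[OF h' assms(4)] by blast
  moreover have "\<not> positive \<one> h" using positive_not_disjoint[OF h assms(2)] assms(3) by blast
  moreover obtain v where v: "v \<in> verts \<Gamma> - stable_verts \<one> h" using exists_unstable[OF h] by blast
  moreover have cl: "gconj \<one> v \<in> carrier G" using v conj_closed by blast
  moreover have "v \<in> verts \<Gamma> - stable_verts \<one> (V - h)"
    using v stabilizes_compl[OF h cl] by (simp add: stable_verts_def)
  ultimately show False
    using positive_iff[OF h _ v] positive_iff[OF h', of \<one> v] expands_compl[OF h cl]
      sign_cases[OF cl h] not_skewers[OF h, of \<one> v] by (auto simp: stable_verts_def)
qed

end


section \<open>Normal forms and words\<close>

context group
begin

text \<open>These are the normal forms of the free product of two copies of \<open>G\<close>, the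
  tag naming the copy. On them \<open>lmul\<close> multiplies by an element of one copy,
  \<open>lconj\<close> conjugates both copies at once, and \<open>lprod\<close> folds both copies
  onto \<open>G\<close>.\<close>

definition normal_form :: "(bool \<times> 'a) list \<Rightarrow> bool" where
  "normal_form l \<longleftrightarrow> distinct_adj (map fst l) \<and> (\<forall>(t, y) \<in> set l. y \<in> carrier G \<and> y \<noteq> \<one>)"

definition lmul :: "bool \<Rightarrow> 'a \<Rightarrow> (bool \<times> 'a) list \<Rightarrow> (bool \<times> 'a) list" where
  "lmul t s l = (if s = \<one> then l else case l of [] \<Rightarrow> [(t, s)] | (t', y) # l' \<Rightarrow>
     if t' = t then (if s \<otimes> y = \<one> then l' else (t, s \<otimes> y) # l') else (t, s) # l)"

definition lconj :: "'a \<Rightarrow> (bool \<times> 'a) list \<Rightarrow> (bool \<times> 'a) list" where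
  "lconj c = map (\<lambda>(t, y). (t, c \<otimes> y \<otimes> inv c))"

definition lprod :: "(bool \<times> 'a) list \<Rightarrow> 'a" where
  "lprod l = foldr (\<lambda>(t, y) z. y \<otimes> z) l \<one>"

lemma normal_form_Nil [simp]: "normal_form []"
  by (simp add: normal_form_def)

lemma normal_form_Cons: "normal_form ((t, y) # l) \<longleftrightarrow>
    y \<in> carrier G \<and> y \<noteq> \<one> \<and> normal_form l \<and> (l = [] \<or> fst (hd l) \<noteq> t)"
  by (cases l) (auto simp: normal_form_def)

lemma lmul_new: "s \<noteq> \<one> \<Longrightarrow> l = [] \<or> fst (hd l) \<noteq> t \<Longrightarrow> lmul t s l = (t, s) # l"
  by (cases l) (auto simp: lmul_def)

lemma lmul_normal_form:
  "s \<in> carrier G \<Longrightarrow> normal_form l \<Longrightarrow> normal_form (lmul t s l)"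
  by (cases l) (auto simp: lmul_def normal_form_Cons)

lemma lmul_mult:
  assumes "s \<in> carrier G" "s' \<in> carrier G" "normal_form l"
  shows "lmul t s (lmul t s' l) = lmul t (s \<otimes> s') l"
proof (cases "l = [] \<or> fst (hd l) \<noteq> t")
  case True
  then show ?thesis using assms by (cases l) (auto simp: lmul_def)
next
  case False
  then obtain y l' where l: "l = (t, y) # l'" by (cases l) auto
  then have y: "y \<in> carrier G" "y \<noteq> \<one>" "l' = [] \<or> fst (hd l') \<noteq> t"
    using assms(3) by (auto simp: normal_form_Cons)
  consider "s = \<one>" | "s' = \<one>" | "s \<noteq> \<one>" "s' \<noteq> \<one>" "s' \<otimes> y = \<one>" | "s \<noteq> \<one>" "s' \<noteq> \<one>" "s' \<otimes> y \<noteq> \<one>" by blast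
  then show ?thesis
  proof cases
    \<comment> \<open>The entry \<open>y\<close> is cancelled and \<open>s\<close> becomes the new
      first entry. On the right the same entry arises as \<open>s \<otimes> s' \<otimes> y\<close>,
      or as the untouched \<open>y\<close> when \<open>s \<otimes> s' = \<one>\<close>.\<close>
    case 3
    then have "s \<otimes> s' \<otimes> y = s" using assms y by (simp add: m_assoc)
    moreover have "s \<otimes> s' \<noteq> \<one> \<or> s \<otimes> s' = \<one> \<and> s = y"
      using calculation y by auto
    ultimately show ?thesis using 3 l y lmul_new[of s l' t] by (auto simp: lmul_def)
  next
    case 4
    have "s \<otimes> (s' \<otimes> y) = s \<otimes> s' \<otimes> y" using assms y by (simp add: m_assoc)
    then show ?thesis using 4 l y by (auto simp: lmul_def)
  qed (use assms in \<open>auto simp: lmul_def\<close>)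
qed

lemma conj_eq_one_iff: "c \<in> carrier G \<Longrightarrow> y \<in> carrier G \<Longrightarrow> c \<otimes> y \<otimes> inv c = \<one> \<longleftrightarrow> y = \<one>"
  using inv_solve_right'[of \<one> "c \<otimes> y" c] by simp

lemma lconj_Nil [simp]: "lconj c [] = []"
  and lconj_Cons [simp]: "lconj c ((t, y) # l) = (t, c \<otimes> y \<otimes> inv c) # lconj c l"
  and lconj_append [simp]: "lconj c (l @ l') = lconj c l @ lconj c l'"
  and map_fst_lconj [simp]: "map fst (lconj c l) = map fst l"
  and lconj_eq_Nil [simp]: "lconj c l = [] \<longleftrightarrow> l = []"
  by (auto simp: lconj_def)

lemma lconj_hd: "l \<noteq> [] \<Longrightarrow> fst (hd (lconj c l)) = fst (hd l)"
  and lconj_last: "l \<noteq> [] \<Longrightarrow> fst (last (lconj c l)) = fst (last l)"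
  by (auto simp: lconj_def hd_map last_map split: prod.splits)

lemma lconj_normal_form: "c \<in> carrier G \<Longrightarrow> normal_form l \<Longrightarrow> normal_form (lconj c l)"
proof (induction l)
  case (Cons a l)
  then show ?case by (cases a) (auto simp: normal_form_Cons conj_eq_one_iff lconj_hd)
qed simp

lemma lconj_one: "normal_form l \<Longrightarrow> lconj \<one> l = l"
proof (induction l)
  case (Cons a l)
  then show ?case by (cases a) (auto simp: normal_form_Cons)
qed simp

lemma lconj_mult:
  "c \<in> carrier G \<Longrightarrow> d \<in> carrier G \<Longrightarrow> normal_form l \<Longrightarrow> lconj c (lconj d l) = lconj (c \<otimes> d) l"
proof (induction l)
  case (Cons a l)
  then show ?case by (cases a) (auto simp: normal_form_Cons inv_mult_group m_assoc)
qed simp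

lemma lconj_lmul:
  assumes "c \<in> carrier G" "s \<in> carrier G" "normal_form l"
  shows "lconj c (lmul t s l) = lmul t (c \<otimes> s \<otimes> inv c) (lconj c l)"
proof (cases l)
  case Nil
  then show ?thesis using assms by (simp add: lmul_def conj_eq_one_iff)
next
  case (Cons a l')
  obtain t' y where a: "a = (t', y)" by (cases a)
  have y: "y \<in> carrier G" using assms(3) Cons a by (simp add: normal_form_Cons)
  have "(c \<otimes> s \<otimes> inv c) \<otimes> (c \<otimes> y \<otimes> inv c) = c \<otimes> (s \<otimes> y) \<otimes> inv c"
    using assms y by (simp add: m_assoc inv_solve_left')
  then show ?thesis using assms Cons a y by (simp add: lmul_def conj_eq_one_iff)
qed

lemma lprod_closed: "normal_form l \<Longrightarrow> lprod l \<in> carrier G"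
  by (induction l) (auto simp: lprod_def normal_form_Cons)

lemma lprod_Nil [simp]: "lprod [] = \<one>"
  and lprod_Cons [simp]: "lprod ((t, y) # l) = y \<otimes> lprod l"
  by (auto simp: lprod_def)

lemma lprod_lmul:
  assumes "s \<in> carrier G" "normal_form l"
  shows "lprod (lmul t s l) = s \<otimes> lprod l"
proof (cases l)
  case Nil
  then show ?thesis using assms by (simp add: lmul_def)
next
  case (Cons a l')
  obtain t' y where a: "a = (t', y)" by (cases a)
  have y: "y \<in> carrier G" "lprod l' \<in> carrier G" using assms(2) Cons a lprod_closed by (auto simp: normal_form_Cons)
  have "s \<otimes> (y \<otimes> lprod l') = s \<otimes> y \<otimes> lprod l'" using assms y by (simp add: m_assoc)
  then show ?thesis using assms Cons a y by (simp add: lmul_def)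
qed

lemma lprod_lconj:
  "c \<in> carrier G \<Longrightarrow> normal_form l \<Longrightarrow> lprod (lconj c l) = c \<otimes> lprod l \<otimes> inv c"
proof (induction l)
  case (Cons a l)
  then show ?case using lprod_closed[of l]
    by (cases a) (auto simp: normal_form_Cons m_assoc inv_solve_left')
qed simp

end

context graph
begin

interpretation A: group "raag G" by (rule group_raag)

section \<open>Commuting words and words over a clique\<close>

lemma raag_letter_inverse:
  assumes "x \<in> verts G"
  shows "word_class G [(x, b)] \<otimes>\<^bsub>raag G\<^esub> word_class G [(x, \<not> b)] = \<one>\<^bsub>raag G\<^esub>"
  using word_class_cancel[OF assms, of b] assms by (simp add: raag_mult raag_one)

lemma raag_gen_inv:
  assumes "x \<in> verts G"
  shows "word_class G [(x, False)] = inv\<^bsub>raag G\<^esub> raag_gen G x"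
  using raag_letter_inverse[OF assms, of False] assms by (intro A.inv_equality[symmetric]) auto

lemma raag_letters_commute:
  assumes "u = v \<or> u \<rightarrow>\<^bsub>G\<^esub> v" "u \<in> verts G" "v \<in> verts G"
  shows "word_class G [(u, b)] \<otimes>\<^bsub>raag G\<^esub> word_class G [(v, c)] =
    word_class G [(v, c)] \<otimes>\<^bsub>raag G\<^esub> word_class G [(u, b)]"
proof -
  have "raag_gen G u \<otimes>\<^bsub>raag G\<^esub> raag_gen G v = raag_gen G v \<otimes>\<^bsub>raag G\<^esub> raag_gen G u"
    using assms raag_gen_commute by blast
  moreover have "\<exists>i::int. word_class G [(x, b)] = raag_gen G x [^]\<^bsub>raag G\<^esub> i" if "x \<in> verts G" for x b
    using that A.int_pow_neg[of "raag_gen G x" 1] by (cases b) (auto simp: raag_gen_inv intro: exI[of _ 1] exI[of _ "-1"])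
  then obtain i j :: int where "word_class G [(u, b)] = raag_gen G u [^]\<^bsub>raag G\<^esub> i"
    "word_class G [(v, c)] = raag_gen G v [^]\<^bsub>raag G\<^esub> j" using assms(2,3) by meson
  ultimately show ?thesis
    using A.int_pow_commute[of "raag_gen G u" "raag_gen G v" i j] assms(2,3) by simp
qed

lemma raag_words_commute:
  assumes "u \<in> gwords (verts G)" "v \<in> gwords (verts G)"
    "\<And>x y. x \<in> fst ` set u \<Longrightarrow> y \<in> fst ` set v \<Longrightarrow> x = y \<or> x \<rightarrow>\<^bsub>G\<^esub> y"
  shows "word_class G u \<otimes>\<^bsub>raag G\<^esub> word_class G v = word_class G v \<otimes>\<^bsub>raag G\<^esub> word_class G u"
proof -
  have letter: "word_class G [(x, b)] \<otimes>\<^bsub>raag G\<^esub> word_class G v = word_class G v \<otimes>\<^bsub>raag G\<^esub> word_class G [(x, b)]"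
    if "x \<in> verts G" "v \<in> gwords (verts G)" "\<And>y. y \<in> fst ` set v \<Longrightarrow> x = y \<or> x \<rightarrow>\<^bsub>G\<^esub> y" for x b v
    using that(2,3)
  proof (induction v)
    case (Cons l v)
    obtain y c where l: "l = (y, c)" by (cases l)
    let ?x = "word_class G [(x, b)]" and ?y = "word_class G [(y, c)]" and ?v = "word_class G v"
    have cl: "?x \<in> carrier (raag G)" "?y \<in> carrier (raag G)" "?v \<in> carrier (raag G)" using Cons that l by auto
    have IH: "?x \<otimes>\<^bsub>raag G\<^esub> ?v = ?v \<otimes>\<^bsub>raag G\<^esub> ?x" using Cons l by auto
    have "?x \<otimes>\<^bsub>raag G\<^esub> ?y = ?y \<otimes>\<^bsub>raag G\<^esub> ?x"
      using raag_letters_commute[of x y b c] Cons l that by auto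
    then have "?x \<otimes>\<^bsub>raag G\<^esub> (?y \<otimes>\<^bsub>raag G\<^esub> ?v) = (?y \<otimes>\<^bsub>raag G\<^esub> ?v) \<otimes>\<^bsub>raag G\<^esub> ?x"
      using cl IH by (metis A.m_assoc)
    then show ?case using Cons l by (simp add: raag_mult)
  qed (use that in \<open>simp add: raag_mult\<close>)
  show ?thesis
    using assms(1,3)
  proof (induction u)
    case (Cons l u)
    obtain x b where l: "l = (x, b)" by (cases l)
    let ?x = "word_class G [(x, b)]" and ?u = "word_class G u" and ?v = "word_class G v"
    have cl: "?x \<in> carrier (raag G)" "?u \<in> carrier (raag G)" "?v \<in> carrier (raag G)" using Cons assms l by auto
    have IH: "?u \<otimes>\<^bsub>raag G\<^esub> ?v = ?v \<otimes>\<^bsub>raag G\<^esub> ?u" using Cons l by auto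
    have "?x \<otimes>\<^bsub>raag G\<^esub> ?v = ?v \<otimes>\<^bsub>raag G\<^esub> ?x"
      using letter[of x v b] Cons l assms by auto
    then have "(?x \<otimes>\<^bsub>raag G\<^esub> ?u) \<otimes>\<^bsub>raag G\<^esub> ?v = ?v \<otimes>\<^bsub>raag G\<^esub> (?x \<otimes>\<^bsub>raag G\<^esub> ?u)"
      using cl IH by (metis A.m_assoc)
    then show ?case using Cons l assms by (simp add: raag_mult)
  qed (use assms in \<open>simp add: raag_mult\<close>)
qed

lemma exponent_one: "exponent v \<one>\<^bsub>raag G\<^esub> = 0"
  using exponent_mult[of "\<one>\<^bsub>raag G\<^esub>" "\<one>\<^bsub>raag G\<^esub>" v] by simp

lemma exponent_nat_pow:
  "A \<in> carrier (raag G) \<Longrightarrow> exponent v (A [^]\<^bsub>raag G\<^esub> (m::nat)) = int m * exponent v A"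
  using A.additive_int_pow[of "carrier (raag G)" "exponent v" A "int m"] A.subgroup_self exponent_mult
  by (simp add: int_pow_int)

lemma exponent_conjugate:
  assumes "A \<in> carrier (raag G)" "B \<in> carrier (raag G)"
  shows "exponent v (A \<otimes>\<^bsub>raag G\<^esub> B \<otimes>\<^bsub>raag G\<^esub> inv\<^bsub>raag G\<^esub> A) = exponent v B"
  using exponent_mult[of A "inv\<^bsub>raag G\<^esub> A" v] assms by (simp add: exponent_mult exponent_one)

lemma raag_gen_pow_neq_one:
  "v \<in> verts G \<Longrightarrow> 0 < (m::nat) \<Longrightarrow> raag_gen G v [^]\<^bsub>raag G\<^esub> m \<noteq> \<one>\<^bsub>raag G\<^esub>"
  using exponent_nat_pow[of "raag_gen G v" v m] exponent_one[of v] by (auto simp: exponent_gen)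

text \<open>Since the exponent sum of its vertex is 0, the first letter has an inverse later in the
  word. All letters commute, so the two can be brought together and cancelled, which shortens the
  word.\<close>

lemma clique_word_eq_one:
  assumes "clique_on G K" "u \<in> gwords K" "\<And>v. v \<in> K \<Longrightarrow> exponent v (word_class G u) = 0"
  shows "word_class G u = \<one>\<^bsub>raag G\<^esub>"
  using assms(2,3)
proof (induction "length u" arbitrary: u rule: less_induct)
  case less
  have KV: "K \<subseteq> verts G" using assms(1) by (simp add: clique_on_def)
  show ?case
  proof (cases u)
    case Nil
    then show ?thesis by (simp add: raag_one)
  next
    case (Cons l v)
    obtain x b where l: "l = (x, b)" by (cases l)
    let ?f = "\<lambda>(y, b) i. if y = x then (if b then i + 1 else i - 1) else (i::int)"
    have xv: "x \<in> K" "v \<in> gwords K" "u \<in> gwords (verts G)" using less.prems(1) KV Cons l by (auto simp: gwords_iff)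
    have sign: "if b then foldr ?f w 0 \<ge> 0 else foldr ?f w 0 \<le> 0" if "(x, \<not> b) \<notin> set w" for w
      using that by (induction w) (auto split: if_splits)
    have "(x, \<not> b) \<in> set v"
    proof (rule ccontr)
      assume "(x, \<not> b) \<notin> set v"
      then show False using sign[of v] less.prems(2)[OF xv(1)] xv(3) Cons l
        by (auto simp: exponent_class split: if_splits)
    qed
    then obtain v1 v2 where v: "v = v1 @ (x, \<not> b) # v2" by (meson split_list)
    have g: "v1 \<in> gwords (verts G)" "v2 \<in> gwords (verts G)" "v1 \<in> gwords K" "v2 \<in> gwords K" "x \<in> verts G"
      using xv KV v gwords_iff[of _ K] gwords_iff[of _ "verts G"] by auto
    let ?c = "\<lambda>b. word_class G [(x, b)]" and ?v = "word_class G"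
    have "?v v1 \<otimes>\<^bsub>raag G\<^esub> ?c (\<not> b) = ?c (\<not> b) \<otimes>\<^bsub>raag G\<^esub> ?v v1"
    proof (rule raag_words_commute)
      fix y z assume "y \<in> fst ` set v1" "z \<in> fst ` set [(x, \<not> b)]"
      then show "y = z \<or> y \<rightarrow>\<^bsub>G\<^esub> z" using assms(1) g gwords_iff[of v1 K] xv(1) by (auto simp: clique_on_def)
    qed (use g in auto)
    moreover have "?v u = ?c b \<otimes>\<^bsub>raag G\<^esub> (?v v1 \<otimes>\<^bsub>raag G\<^esub> ?c (\<not> b)) \<otimes>\<^bsub>raag G\<^esub> ?v v2"
      using Cons l v g by (simp add: raag_mult)
    moreover have "?c b \<otimes>\<^bsub>raag G\<^esub> (?c (\<not> b) \<otimes>\<^bsub>raag G\<^esub> ?v v1) \<otimes>\<^bsub>raag G\<^esub> ?v v2 = ?v v1 \<otimes>\<^bsub>raag G\<^esub> ?v v2"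
      using raag_letter_inverse[OF g(5), of b] g by (simp flip: A.m_assoc)
    ultimately have eq: "?v u = ?v (v1 @ v2)" using g by (simp add: raag_mult)
    then have "?v (v1 @ v2) = \<one>\<^bsub>raag G\<^esub>"
      using less.hyps[of "v1 @ v2"] less.prems(2) g Cons v by simp
    then show ?thesis using eq by simp
  qed
qed

text \<open>The generators \<open>u\<close> and \<open>v\<close> are sent to the two elementary transvections of \<open>\<int>\<^sup>2\<close>.\<close>

lemma raag_gen_powers_noncommuting:
  assumes "u \<in> verts G" "v \<in> verts G" "u \<noteq> v" "\<not> u \<rightarrow>\<^bsub>G\<^esub> v" "0 < i" "0 < j"
  shows "raag_gen G u [^]\<^bsub>raag G\<^esub> (i::nat) \<otimes>\<^bsub>raag G\<^esub> raag_gen G v [^]\<^bsub>raag G\<^esub> (j::nat) \<noteq>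
    raag_gen G v [^]\<^bsub>raag G\<^esub> j \<otimes>\<^bsub>raag G\<^esub> raag_gen G u [^]\<^bsub>raag G\<^esub> i"
proof
  define f :: "'a \<times> bool \<Rightarrow> int \<times> int \<Rightarrow> int \<times> int" where
    "f = (\<lambda>(x, b) (p, q). if x = u then (if b then p + q else p - q, q)
       else if x = v then (p, if b then q + p else q - p) else (p, q))"
  have "\<not> v \<rightarrow>\<^bsub>G\<^esub> u" using assms(4) graph_symmetric[of v u] by blast
  then interpret F: raag_action G f UNIV
    by unfold_locales (use assms(4) in \<open>auto simp: f_def split: prod.splits\<close>)
  let ?E = "word_eval f"
  have gen: "?E (raag_gen G u) (p, q) = (p + q, q)" "?E (raag_gen G v) (p, q) = (p, q + p)" for p q
    using assms(1-3) by (simp_all add: F.word_eval_class) (simp_all add: f_def)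
  have "?E (raag_gen G u [^]\<^bsub>raag G\<^esub> m) (p, q) = (p + int m * q, q)" for m :: nat and p q
    by (induction m arbitrary: p)
      (use assms(1) in \<open>auto simp: F.word_eval_one F.word_eval_mult gen algebra_simps\<close>)
  moreover have "?E (raag_gen G v [^]\<^bsub>raag G\<^esub> m) (p, q) = (p, q + int m * p)" for m :: nat and p q
    by (induction m arbitrary: q)
      (use assms(2) in \<open>auto simp: F.word_eval_one F.word_eval_mult gen algebra_simps\<close>)
  moreover assume "raag_gen G u [^]\<^bsub>raag G\<^esub> i \<otimes>\<^bsub>raag G\<^esub> raag_gen G v [^]\<^bsub>raag G\<^esub> j =
    raag_gen G v [^]\<^bsub>raag G\<^esub> j \<otimes>\<^bsub>raag G\<^esub> raag_gen G u [^]\<^bsub>raag G\<^esub> i"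
  \<comment> \<open>Starting from \<open>(1, 0)\<close>, one order of the factors gives
    \<open>(1 + i * j, j)\<close> and the other \<open>(1, j)\<close>.\<close>
  then have "?E (raag_gen G u [^]\<^bsub>raag G\<^esub> i) (?E (raag_gen G v [^]\<^bsub>raag G\<^esub> j) (1, 0)) =
    ?E (raag_gen G v [^]\<^bsub>raag G\<^esub> j) (?E (raag_gen G u [^]\<^bsub>raag G\<^esub> i) (1, 0))"
    using F.word_eval_mult assms(1,2) by (metis A.nat_pow_closed UNIV_I gwords_simps(1,3) word_class_carrier)
  ultimately show False using assms(5,6) by simp
qed

lemma raag_gen_invariant:
  assumes "\<And>g v. g \<in> carrier (raag G) \<Longrightarrow> v \<in> verts G \<Longrightarrow> F (g \<otimes>\<^bsub>raag G\<^esub> raag_gen G v) = F g"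
    and "g \<in> carrier (raag G)"
  shows "F g = F \<one>\<^bsub>raag G\<^esub>"
proof -
  obtain w where w: "w \<in> gwords (verts G)" "g = word_class G w" using assms(2) by (rule raag_carrierE)
  have "F (word_class G w) = F \<one>\<^bsub>raag G\<^esub>"
    using w(1)
  proof (induction w rule: rev_induct)
    case (snoc l w)
    obtain x b where l: "l = (x, b)" by (cases l)
    have x: "x \<in> verts G" "w \<in> gwords (verts G)" using snoc l by auto
    have "F (word_class G (w @ [(x, b)])) = F (word_class G w)"
    proof (cases b)
      case True
      then show ?thesis using assms(1)[of "word_class G w" x] x by (simp add: raag_mult)
    next
      case False
      have "word_class G (w @ [(x, False)]) \<otimes>\<^bsub>raag G\<^esub> raag_gen G x =
        word_class G w \<otimes>\<^bsub>raag G\<^esub> (word_class G [(x, False)] \<otimes>\<^bsub>raag G\<^esub> raag_gen G x)"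
        using x by (simp add: raag_mult)
      also have "\<dots> = word_class G w" using raag_letter_inverse[OF x(1), of False] x by simp
      finally show ?thesis using assms(1)[of "word_class G (w @ [(x, False)])" x] x False by simp
    qed
    then show ?case using snoc l x by simp
  qed (simp add: raag_one)
  then show ?thesis using w by simp
qed

end


section \<open>The splitting along a separating clique\<close>

locale split_graph = graph G for G :: "('a, 'b) pre_digraph" +
  fixes K P Q :: "'a set"
  assumes verts_eq: "verts G = K \<union> P \<union> Q"
    and disjoint: "K \<inter> P = {}" "K \<inter> Q = {}" "P \<inter> Q = {}"
    and clique: "clique_on G K"
    and parts_nonempty: "P \<noteq> {}" "Q \<noteq> {}"
    and no_arc: "p \<in> P \<Longrightarrow> q \<in> Q \<Longrightarrow> \<not> p \<rightarrow>\<^bsub>G\<^esub> q"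
begin

sublocale A: group "raag G" by (rule group_raag)

text \<open>The group is \<open>(N\<^sub>P * N\<^sub>Q) \<rtimes> A\<^sub>K\<close>, where \<open>N\<^sub>P\<close> and \<open>N\<^sub>Q\<close> are the kernels of the
  retractions of \<open>A\<^bsub>K \<union> P\<^esub>\<close> and \<open>A\<^bsub>K \<union> Q\<^esub>\<close> onto \<open>A\<^sub>K\<close>. It acts on the alternating normal forms of
  the free product; the tags \<^const>\<open>True\<close> and \<^const>\<open>False\<close> mark the two factors. The entries may
  be arbitrary nontrivial elements of the whole group, since the relations of the action
  hold for these as well.\<close>

definition step :: "'a \<times> bool \<Rightarrow> (bool \<times> 'a gword set) list \<Rightarrow> (bool \<times> 'a gword set) list" where
  "step = (\<lambda>(x, b) l. if x \<in> K then A.lconj (word_class G [(x, b)]) l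
     else A.lmul (x \<in> P) (word_class G [(x, b)]) l)"

abbreviation forms :: "(bool \<times> 'a gword set) list set" where
  "forms \<equiv> {l. A.normal_form l}"

lemma word_class_mult_inv:
  assumes "x \<in> verts G" "y \<in> verts G" "x = y \<or> x \<rightarrow>\<^bsub>G\<^esub> y"
  shows "word_class G [(x, b)] \<otimes>\<^bsub>raag G\<^esub> word_class G [(y, c)] \<otimes>\<^bsub>raag G\<^esub> inv\<^bsub>raag G\<^esub> word_class G [(x, b)] =
    word_class G [(y, c)]"
  using raag_letters_commute[OF assms(3,1,2), of b c] assms by (simp add: A.m_assoc)

sublocale action: raag_action G step forms
proof
  fix x b s assume x: "x \<in> verts G" and s: "s \<in> forms"
  show "step (x, b) s \<in> forms"
    using x s by (auto simp: step_def A.lconj_normal_form A.lmul_normal_form)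
  show "step (x, b) (step (x, \<not> b) s) = s"
    using x s raag_letter_inverse[OF x, of b]
    by (auto simp: step_def A.lconj_mult A.lmul_mult A.lconj_one) (auto simp: A.lmul_def)
next
  fix u v s assume uv: "u \<rightarrow>\<^bsub>G\<^esub> v" and s: "s \<in> forms"
  have V: "u \<in> verts G" "v \<in> verts G" using uv adj_in_verts by blast+
  let ?u = "word_class G [(u, False)]" and ?v = "word_class G [(v, False)]"
  have comm: "?u \<otimes>\<^bsub>raag G\<^esub> ?v = ?v \<otimes>\<^bsub>raag G\<^esub> ?u" using raag_letters_commute uv V by blast
  have conj: "?u \<otimes>\<^bsub>raag G\<^esub> ?v \<otimes>\<^bsub>raag G\<^esub> inv\<^bsub>raag G\<^esub> ?u = ?v" "?v \<otimes>\<^bsub>raag G\<^esub> ?u \<otimes>\<^bsub>raag G\<^esub> inv\<^bsub>raag G\<^esub> ?v = ?u"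
    using word_class_mult_inv uv V graph_symmetric[OF uv] by blast+
  \<comment> \<open>Adjacent vertices outside \<open>K\<close> lie in the same part, so their
    letters act by multiplication in the same factor.\<close>
  have "u \<notin> K \<Longrightarrow> v \<notin> K \<Longrightarrow> u \<in> P \<longleftrightarrow> v \<in> P"
    using uv V graph_symmetric[OF uv] no_arc verts_eq by blast
  then show "step (u, False) (step (v, False) s) = step (v, False) (step (u, False) s)"
    using s V comm conj A.lmul_mult[of ?u ?v s] A.lmul_mult[of ?v ?u s]
    by (auto simp: step_def A.lconj_mult A.lconj_lmul)
qed

section \<open>The action on normal forms and its effect on tags\<close>

definition act :: "'a gword set \<Rightarrow> (bool \<times> 'a gword set) list \<Rightarrow> (bool \<times> 'a gword set) list" where
  "act = word_eval step"

lemma act_class: "w \<in> gwords (verts G) \<Longrightarrow> l \<in> forms \<Longrightarrow> act (word_class G w) l = foldr step w l"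
  unfolding act_def by (rule action.word_eval_class)

lemma act_closed: "g \<in> carrier (raag G) \<Longrightarrow> l \<in> forms \<Longrightarrow> act g l \<in> forms"
  unfolding act_def by (rule action.word_eval_closed)

lemma act_mult: "g \<in> carrier (raag G) \<Longrightarrow> h \<in> carrier (raag G) \<Longrightarrow> l \<in> forms \<Longrightarrow>
    act (g \<otimes>\<^bsub>raag G\<^esub> h) l = act g (act h l)"
  unfolding act_def by (rule action.word_eval_mult)

lemma act_one: "l \<in> forms \<Longrightarrow> act \<one>\<^bsub>raag G\<^esub> l = l"
  unfolding act_def by (rule action.word_eval_one)

lemma act_inv: "g \<in> carrier (raag G) \<Longrightarrow> l \<in> forms \<Longrightarrow> act (inv\<^bsub>raag G\<^esub> g) (act g l) = l"
  and act_inv': "g \<in> carrier (raag G) \<Longrightarrow> l \<in> forms \<Longrightarrow> act g (act (inv\<^bsub>raag G\<^esub> g) l) = l"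
  using act_mult[of "inv\<^bsub>raag G\<^esub> g" g l] act_mult[of g "inv\<^bsub>raag G\<^esub> g" l] by (simp_all add: act_one)

lemma K_subset: "K \<subseteq> verts G" using verts_eq by blast

lemma gwords_K: "u \<in> gwords K \<Longrightarrow> u \<in> gwords (verts G)"
  using K_subset by (induction u) auto

lemma foldr_step_clique:
  "u \<in> gwords K \<Longrightarrow> l \<in> forms \<Longrightarrow> foldr step u l = A.lconj (word_class G u) l"
proof (induction u)
  case Nil
  then show ?case by (simp add: A.lconj_one flip: raag_one)
next
  case (Cons a u)
  obtain x b where a: "a = (x, b)" by (cases a)
  have "x \<in> verts G" "u \<in> gwords (verts G)" using Cons a K_subset gwords_K by auto
  then show ?case using Cons a A.lconj_mult[of "word_class G [(x, b)]" "word_class G u" l]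
    by (simp add: step_def raag_mult)
qed

text \<open>Up to a right factor from \<open>A\<^sub>K\<close>, \<open>lprod\<close> intertwines the
  action with left multiplication: a letter outside \<open>K\<close> multiplies it on the left, and
  a letter of \<open>K\<close> conjugates it, which is compensated on the right. With empty forms
  this shows that an element fixing \<open>[]\<close> lies in \<open>A\<^sub>K\<close>.\<close>

lemma lprod_foldr_step:
  assumes "w \<in> gwords (verts G)" "l \<in> forms"
  shows "\<exists>u \<in> gwords K. word_class G w \<otimes>\<^bsub>raag G\<^esub> A.lprod l = A.lprod (foldr step w l) \<otimes>\<^bsub>raag G\<^esub> word_class G u"
  using assms(1)
proof (induction w)
  case Nil
  then show ?case using A.lprod_closed assms(2) by (intro bexI[of _ "[]"]) (auto simp flip: raag_one)
next
  case (Cons a w)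
  obtain x b where a: "a = (x, b)" by (cases a)
  have x: "x \<in> verts G" "w \<in> gwords (verts G)" using Cons.prems a by auto
  let ?x = "word_class G [(x, b)]" and ?m = "foldr step w l"
  obtain u where u: "u \<in> gwords K"
    "word_class G w \<otimes>\<^bsub>raag G\<^esub> A.lprod l = A.lprod ?m \<otimes>\<^bsub>raag G\<^esub> word_class G u" using Cons.IH x by blast
  have m: "A.normal_form ?m" using action.foldr_closed[OF x(2) assms(2)] by simp
  have cl: "?x \<in> carrier (raag G)" "A.lprod ?m \<in> carrier (raag G)" "word_class G u \<in> carrier (raag G)"
    "word_class G w \<in> carrier (raag G)" "A.lprod l \<in> carrier (raag G)"
    using x gwords_K[OF u(1)] A.lprod_closed[OF m] A.lprod_closed assms(2) by auto
  have "word_class G (a # w) \<otimes>\<^bsub>raag G\<^esub> A.lprod l = ?x \<otimes>\<^bsub>raag G\<^esub> (word_class G w \<otimes>\<^bsub>raag G\<^esub> A.lprod l)"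
    using raag_mult[of "[(x, b)]" G w] x cl a by (simp flip: A.m_assoc)
  also have "\<dots> = ?x \<otimes>\<^bsub>raag G\<^esub> (A.lprod ?m \<otimes>\<^bsub>raag G\<^esub> word_class G u)" by (simp only: u(2))
  finally have eq: "word_class G (a # w) \<otimes>\<^bsub>raag G\<^esub> A.lprod l = ?x \<otimes>\<^bsub>raag G\<^esub> (A.lprod ?m \<otimes>\<^bsub>raag G\<^esub> word_class G u)" .
  show ?case
  proof (cases "x \<in> K")
    case True
    have "A.lprod (foldr step (a # w) l) \<otimes>\<^bsub>raag G\<^esub> word_class G (a # u) =
        (?x \<otimes>\<^bsub>raag G\<^esub> A.lprod ?m \<otimes>\<^bsub>raag G\<^esub> inv\<^bsub>raag G\<^esub> ?x) \<otimes>\<^bsub>raag G\<^esub> (?x \<otimes>\<^bsub>raag G\<^esub> word_class G u)"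
      using True a x gwords_K[OF u(1)] A.lprod_lconj[OF cl(1) m] by (simp add: step_def raag_mult)
    also have "\<dots> = ?x \<otimes>\<^bsub>raag G\<^esub> (A.lprod ?m \<otimes>\<^bsub>raag G\<^esub> word_class G u)"
      using cl by (simp add: A.m_assoc A.inv_solve_left')
    finally show ?thesis using eq True a u(1) by (intro bexI[of _ "a # u"]) auto
  next
    case False
    then have "A.lprod (foldr step (a # w) l) = ?x \<otimes>\<^bsub>raag G\<^esub> A.lprod ?m"
      using a A.lprod_lmul[OF cl(1) m] by (simp add: step_def)
    then show ?thesis using eq u(1) cl by (intro bexI[of _ u]) (simp_all add: A.m_assoc)
  qed
qed

lemma act_Nil_clique:
  assumes "g \<in> carrier (raag G)" "act g [] = []"
  obtains u where "u \<in> gwords K" "g = word_class G u"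
proof -
  obtain w where w: "w \<in> gwords (verts G)" "g = word_class G w" using assms(1) by (rule raag_carrierE)
  then obtain u where "u \<in> gwords K" "g \<otimes>\<^bsub>raag G\<^esub> A.lprod [] = A.lprod (act g []) \<otimes>\<^bsub>raag G\<^esub> word_class G u"
    using lprod_foldr_step[of w "[]"] by (auto simp: act_class)
  then show ?thesis using that assms gwords_K by simp
qed

text \<open>As long as the image of \<open>[]\<close> is nonempty, letters outside \<open>K\<close>
  alter only its front, and conjugation by letters of \<open>K\<close> keeps all tags. By the
  condition on tags, \<open>l\<close> does not merge with the end of that image.\<close>

lemma foldr_step_append:
  assumes "w \<in> gwords (verts G)" "foldr step w [] \<noteq> []"
    and l: "l \<in> forms" "l = [] \<or> fst (hd l) \<noteq> fst (last (foldr step w []))"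
  shows "\<exists>l'. foldr step w l = foldr step w [] @ l' \<and> map fst l' = map fst l"
  using assms(1,2,4)
proof (induction w)
  case (Cons a w)
  obtain x b where a: "a = (x, b)" by (cases a)
  have x: "x \<in> verts G" "w \<in> gwords (verts G)" using Cons.prems a by auto
  let ?x = "word_class G [(x, b)]" and ?m = "foldr step w []" and ?t = "x \<in> P"
  have m: "A.normal_form ?m" using action.foldr_closed[OF x(2)] by simp
  have xc: "?x \<in> carrier (raag G)" using x by simp
  have x1: "?x \<noteq> \<one>\<^bsub>raag G\<^esub>"
    using exponent_one[of x] x exponent_class[of "[(x, b)]" x] by (auto split: if_splits)
  show ?case
  proof (cases "x \<in> K")
    case True
    then have st: "step a k = A.lconj ?x k" for k using a by (simp add: step_def)
    then have "?m \<noteq> []" using Cons.prems by simp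
    moreover from this have "l = [] \<or> fst (hd l) \<noteq> fst (last ?m)" using Cons.prems st A.lconj_last by simp
    ultimately obtain l' where "foldr step w l = ?m @ l'" "map fst l' = map fst l" using Cons.IH x by blast
    then show ?thesis using st by (intro exI[of _ "A.lconj ?x l'"]) simp
  next
    case False
    then have st: "step a k = A.lmul ?t ?x k" for k using a by (simp add: step_def)
    show ?thesis
    proof (cases "?m = []")
      \<comment> \<open>Here \<open>w\<close> maps \<open>[]\<close> back to itself, so it
        represents an element of \<open>A\<^sub>K\<close> and has merely conjugated
        \<open>l\<close>.\<close>
      case True
      then have "act (word_class G w) [] = []" using x by (simp add: act_class)
      then obtain u where u: "u \<in> gwords K" "word_class G w = word_class G u"
        using act_Nil_clique x by blast
      have "foldr step w l = A.lconj (word_class G u) l"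
        using act_class[OF x(2) l(1)] act_class[OF gwords_K[OF u(1)] l(1)] foldr_step_clique[OF u(1) l(1)] u(2) by simp
      moreover have "l = [] \<or> fst (hd l) \<noteq> ?t" using Cons.prems(3) True st x1 by (simp add: A.lmul_new)
      then have "A.lconj (word_class G u) l = [] \<or> fst (hd (A.lconj (word_class G u) l)) \<noteq> ?t"
        using A.lconj_hd[of l] by (cases "l = []") simp_all
      ultimately have "step a (foldr step w l) = (?t, ?x) # A.lconj (word_class G u) l"
        using A.lmul_new[OF x1] unfolding st by simp
      moreover have "step a ?m = [(?t, ?x)]" using True st A.lmul_new[OF x1] by simp
      ultimately show ?thesis by (intro exI[of _ "A.lconj (word_class G u) l"]) simp
    next
      case m_ne: False
      then obtain t y m' where my: "?m = (t, y) # m'" by (cases ?m) auto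
      have last: "step a ?m \<noteq> [] \<Longrightarrow> fst (last (step a ?m)) = fst (last ?m)"
        using my st x1 m by (auto simp: A.lmul_def A.normal_form_Cons)
      then have "l = [] \<or> fst (hd l) \<noteq> fst (last ?m)" using Cons.prems by simp
      then obtain l' where l': "foldr step w l = ?m @ l'" "map fst l' = map fst l" using Cons.IH x m_ne by blast
      show ?thesis
      proof (cases "step a ?m = []")
        case True
        then show ?thesis using Cons.prems by simp
      next
        case False
        then show ?thesis using my st x1 l' by (auto simp: A.lmul_def)
      qed
    qed
  qed
qed simp

lemma act_append:
  assumes "g \<in> carrier (raag G)" "act g [] \<noteq> []" "l \<in> forms" "l = [] \<or> fst (hd l) \<noteq> fst (last (act g []))"
  shows "\<exists>l'. act g l = act g [] @ l' \<and> map fst l' = map fst l"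
  using assms
  by (elim raag_carrierE) (simp add: act_class foldr_step_append)

section \<open>The halfspaces of the splitting\<close>

definition base :: "(bool \<times> 'a gword set) list set" where
  "base = {l \<in> forms. l \<noteq> [] \<and> fst (hd l)}"

lemma base_subset: "base \<subseteq> forms" by (auto simp: base_def)

lemma act_image_compl:
  assumes "g \<in> carrier (raag G)" "h \<subseteq> forms"
  shows "act g ` (forms - h) = forms - act g ` h"
proof
  show "act g ` (forms - h) \<subseteq> forms - act g ` h"
    using act_closed[OF assms(1)] act_inv[OF assms(1)] assms(2) by (force dest: arg_cong[of _ _ "act (inv\<^bsub>raag G\<^esub> g)"])
  show "forms - act g ` h \<subseteq> act g ` (forms - h)"
  proof
    fix l assume l: "l \<in> forms - act g ` h"
    have "l = act g (act (inv\<^bsub>raag G\<^esub> g) l)" using act_inv'[OF assms(1)] l by simp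
    moreover have "act (inv\<^bsub>raag G\<^esub> g) l \<in> forms" using act_closed assms(1) l by blast
    ultimately show "l \<in> act g ` (forms - h)" using l by blast
  qed
qed

lemma act_image_mult:
  "g \<in> carrier (raag G) \<Longrightarrow> h \<in> carrier (raag G) \<Longrightarrow> S \<subseteq> forms \<Longrightarrow> act (g \<otimes>\<^bsub>raag G\<^esub> h) ` S = act g ` act h ` S"
  unfolding image_image by (intro image_cong refl act_mult) auto

lemma act_image_one: "S \<subseteq> forms \<Longrightarrow> act \<one>\<^bsub>raag G\<^esub> ` S = S"
  by (subst image_cong[of S S _ id]) (use act_one in auto)

lemma act_image_inv: "g \<in> carrier (raag G) \<Longrightarrow> S \<subseteq> forms \<Longrightarrow> act (inv\<^bsub>raag G\<^esub> g) ` act g ` S = S"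
  and act_image_inv': "g \<in> carrier (raag G) \<Longrightarrow> S \<subseteq> forms \<Longrightarrow> act g ` act (inv\<^bsub>raag G\<^esub> g) ` S = S"
  by (simp_all add: act_image_one flip: act_image_mult)

lemma act_base_clique:
  assumes "g \<in> carrier (raag G)" "act g [] = []"
  shows "act g ` base = base"
proof -
  have sub: "act g ` base \<subseteq> base" if g: "g \<in> carrier (raag G)" "act g [] = []" for g
  proof -
    obtain u where u: "u \<in> gwords K" "g = word_class G u" using act_Nil_clique g by blast
    have "act g l = A.lconj g l" if "l \<in> forms" for l
      using act_class[OF gwords_K[OF u(1)] that] foldr_step_clique[OF u(1) that] u(2) by simp
    then show ?thesis using g A.lconj_normal_form A.lconj_hd by (auto simp: base_def)
  qed
  have "act (inv\<^bsub>raag G\<^esub> g) [] = []" using act_inv[OF assms(1), of "[]"] assms(2) by simp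
  then have "act (inv\<^bsub>raag G\<^esub> g) ` base \<subseteq> base" using sub assms(1) by simp
  then have "act g ` act (inv\<^bsub>raag G\<^esub> g) ` base \<subseteq> act g ` base" by (rule image_mono)
  moreover have "act g ` act (inv\<^bsub>raag G\<^esub> g) ` base = base"
    using act_image_inv'[OF assms(1) base_subset] .
  ultimately show ?thesis using sub[OF assms] by simp
qed

text \<open>The last tag of \<open>act g []\<close> decides which of \<open>base\<close> and its
  complement is carried by \<open>g\<close> to forms that extend \<open>act g []\<close>;
  \<open>act_true_last\<close> is the other case.\<close>

lemma act_false_last:
  assumes "g \<in> carrier (raag G)" "act g [] \<noteq> []" "\<not> fst (last (act g []))" "l \<in> base"
  shows "\<exists>l'. act g l = act g [] @ l' \<and> l' \<noteq> []"
  using act_append[OF assms(1,2), of l] assms(3,4) by (auto simp: base_def)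

lemma act_true_last:
  assumes "g \<in> carrier (raag G)" "act g [] \<noteq> []" "fst (last (act g []))" "l \<in> forms - base"
  shows "\<exists>l'. act g l = act g [] @ l'"
  using act_append[OF assms(1,2), of l] assms(3,4) by (auto simp: base_def)

definition nested_pair where
  "nested_pair h k \<longleftrightarrow> h \<subseteq> k \<or> k \<subseteq> h \<or> h \<inter> k = {} \<or> h \<union> k = forms"

text \<open>Either the translate of \<open>base\<close> or its complement consists of extensions of
  \<open>act g []\<close>. All of these have the same first tag, so they lie on one side of
  \<open>base\<close>.\<close>

lemma nested_base:
  assumes g: "g \<in> carrier (raag G)"
  shows "nested_pair base (act g ` base)"
proof (cases "act g [] = []")
  case True
  then show ?thesis using act_base_clique[OF g] by (simp add: nested_pair_def)
next
  case ne: False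
  have im: "act g ` base \<subseteq> forms" "act g ` (forms - base) = forms - act g ` base" "act g ` (forms - base) \<subseteq> forms"
    using act_closed[OF g] base_subset act_image_compl[OF g base_subset] by auto
  show ?thesis
  proof (cases "fst (last (act g []))")
    case True
    have hd: "l \<in> base \<longleftrightarrow> fst (hd (act g []))" if "l \<in> act g ` (forms - base)" for l
      using that act_true_last[OF g ne True] ne im(3) by (fastforce simp: base_def)
    show ?thesis
    proof (cases "fst (hd (act g []))")
      case True
      then have "forms - act g ` base \<subseteq> base" using hd im(2) by blast
      then show ?thesis using im(1) base_subset unfolding nested_pair_def by blast
    next
      case False
      then have "(forms - act g ` base) \<inter> base = {}" using hd im(2) by blast
      then show ?thesis using base_subset unfolding nested_pair_def by blast
    qed
  next
    case False
    have hd: "l \<in> base \<longleftrightarrow> fst (hd (act g []))" if "l \<in> act g ` base" for l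
      using that act_false_last[OF g ne False] ne im(1) by (fastforce simp: base_def)
    then show ?thesis unfolding nested_pair_def by blast
  qed
qed

definition walls :: "(bool \<times> 'a gword set) list set set" where
  "walls = {h. \<exists>g \<in> carrier (raag G). h = act g ` base \<or> h = forms - act g ` base}"

lemma nested_translates:
  assumes g: "g \<in> carrier (raag G)" and k: "k \<in> carrier (raag G)"
  shows "nested_pair (act g ` base) (act k ` base)"
proof -
  let ?h = "inv\<^bsub>raag G\<^esub> g \<otimes>\<^bsub>raag G\<^esub> k"
  have inj: "inj_on (act g) forms" by (rule inj_on_inverseI[of _ "act (inv\<^bsub>raag G\<^esub> g)"]) (rule act_inv[OF g])
  have "g \<otimes>\<^bsub>raag G\<^esub> ?h = k" using g k by (simp flip: A.m_assoc)
  then have k_eq: "act k ` base = act g ` act ?h ` base" using act_image_mult[OF g _ base_subset, of ?h] g k by simp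
  have sub: "act ?h ` base \<subseteq> forms" using act_closed[of ?h] g k base_subset by auto
  have surj: "act g ` forms = forms" using act_image_compl[OF g, of "{}"] by simp
  have "nested_pair base (act ?h ` base)" using nested_base[of ?h] g k by simp
  then consider "base \<subseteq> act ?h ` base" | "act ?h ` base \<subseteq> base" | "base \<inter> act ?h ` base = {}" | "base \<union> act ?h ` base = forms"
    unfolding nested_pair_def by blast
  then show ?thesis
  proof cases
    case 3
    then have "act g ` base \<inter> act k ` base = {}"
      unfolding k_eq using inj_on_image_Int[OF inj base_subset sub] by simp
    then show ?thesis by (simp add: nested_pair_def)
  next
    case 4
    then have "act g ` base \<union> act k ` base = forms" unfolding k_eq using surj by (simp flip: image_Un)
    then show ?thesis by (simp add: nested_pair_def)
  qed (auto simp: nested_pair_def k_eq image_mono)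
qed

text \<open>One side of the translated halfspace consists of extensions of \<open>act g []\<close>,
  and each side contains \<open>a\<close> or \<open>b\<close>.\<close>

lemma separated_prefix:
  assumes g: "g \<in> carrier (raag G)" and a: "a \<in> act g ` base" and b: "b \<in> forms - act g ` base"
  shows "prefix (act g []) a \<or> prefix (act g []) b"
proof (cases "act g [] = []")
  case ne: False
  obtain a' where a': "a = act g a'" "a' \<in> base" using a by blast
  obtain b' where b': "b = act g b'" "b' \<in> forms - base"
    using b act_image_compl[OF g base_subset] by blast
  show ?thesis
    using act_true_last[OF g ne _ b'(2)] act_false_last[OF g ne _ a'(2)] a'(1) b'(1) by (auto simp: prefix_def)
qed simp

lemma base_translate_determined:
  assumes g: "g \<in> carrier (raag G)" and k: "k \<in> carrier (raag G)" and eq: "act g [] = act k []"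
  shows "act g ` base = act k ` base"
proof -
  let ?h = "inv\<^bsub>raag G\<^esub> g \<otimes>\<^bsub>raag G\<^esub> k"
  have "act ?h [] = []" using act_mult[of "inv\<^bsub>raag G\<^esub> g" k "[]"] act_inv[OF g, of "[]"] g k eq by simp
  then have "act ?h ` base = base" using act_base_clique g k by simp
  moreover have "g \<otimes>\<^bsub>raag G\<^esub> ?h = k" using g k by (simp flip: A.m_assoc)
  ultimately show ?thesis using act_image_mult[OF g _ base_subset, of ?h] g k by simp
qed

text \<open>A translate of \<open>base\<close> is determined by \<open>act g []\<close>, and
  \<open>a\<close> and \<open>b\<close> have finitely many prefixes. The function \<open>h\<close>
  recovers the translate from the prefix.\<close>

lemma finite_separating_translates:
  "finite {act g ` base | g. g \<in> carrier (raag G) \<and> (prefix (act g []) a \<or> prefix (act g []) b)}" (is "finite ?F")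
proof -
  define h where "h l = act (SOME g. g \<in> carrier (raag G) \<and> act g [] = l) ` base" for l
  have "act g ` base = h (act g [])" if "g \<in> carrier (raag G)" for g
  proof -
    let ?P = "\<lambda>k. k \<in> carrier (raag G) \<and> act k [] = act g []"
    have "?P (SOME k. ?P k)" by (rule someI[of ?P g]) (use that in simp)
    then show ?thesis
      unfolding h_def by (elim conjE) (rule base_translate_determined[OF that _ HOL.sym])
  qed
  then have "?F \<subseteq> h ` (set (prefixes a) \<union> set (prefixes b))" by fastforce
  then show ?thesis by (rule finite_subset) simp
qed

lemma base_nonempty: "\<exists>s. [(True, s)] \<in> base"
proof -
  obtain p where "p \<in> P" using parts_nonempty by blast
  then have "p \<in> verts G" using verts_eq by blast
  then show ?thesis using raag_gen_pow_neq_one[of p 1]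
    by (intro exI[of _ "raag_gen G p"]) (auto simp: base_def A.normal_form_Cons)
qed

lemma halfspaces_walls: "halfspaces forms walls"
proof
  fix h k assume h: "h \<in> walls"
  then obtain g where g: "g \<in> carrier (raag G)" "h = act g ` base \<or> h = forms - act g ` base" by (auto simp: walls_def)
  have sub: "act g ` base \<subseteq> forms" using act_closed[OF g(1)] base_subset by blast
  then show "h \<subseteq> forms" using g by blast
  have "[] \<in> forms - base" by (simp add: base_def)
  then have "forms - act g ` base \<noteq> {}" using act_image_compl[OF g(1) base_subset] by blast
  then show "h \<noteq> {}" using g(2) base_nonempty by blast
  show "forms - h \<in> walls"
    using g double_diff[OF sub subset_refl] unfolding walls_def by blast
  assume "k \<in> walls"
  then obtain g' where g': "g' \<in> carrier (raag G)" "k = act g' ` base \<or> k = forms - act g' ` base" by (auto simp: walls_def)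
  have sub': "act g' ` base \<subseteq> forms" using act_closed[OF g'(1)] base_subset by blast
  show "h \<subseteq> k \<or> k \<subseteq> h \<or> h \<inter> k = {} \<or> h \<union> k = forms"
    using nested_translates[OF g(1) g'(1)] g(2) g'(2) sub sub' unfolding nested_pair_def by blast
next
  fix a b assume ab: "a \<in> forms" "b \<in> forms"
  let ?F = "{act g ` base | g. g \<in> carrier (raag G) \<and> (prefix (act g []) a \<or> prefix (act g []) b)}"
  have "{h \<in> walls. a \<in> h \<and> b \<notin> h} \<subseteq> ?F \<union> (\<lambda>h. forms - h) ` ?F"
  proof
    fix h assume h: "h \<in> {h \<in> walls. a \<in> h \<and> b \<notin> h}"
    then obtain g where g: "g \<in> carrier (raag G)" "h = act g ` base \<or> h = forms - act g ` base" by (auto simp: walls_def)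
    then have "prefix (act g []) a \<or> prefix (act g []) b"
      using separated_prefix[OF g(1), of a b] separated_prefix[OF g(1), of b a] h ab by blast
    then have "act g ` base \<in> ?F" using g(1) by blast
    then show "h \<in> ?F \<union> (\<lambda>h. forms - h) ` ?F" using g(2) by blast
  qed
  then show "finite {h \<in> walls. a \<in> h \<and> b \<notin> h}"
    using finite_separating_translates by (meson finite_UnI finite_imageI finite_subset)
qed

lemma walls_act:
  assumes "g \<in> carrier (raag G)" "h \<in> walls"
  shows "act g ` h \<in> walls"
proof -
  obtain k where k: "k \<in> carrier (raag G)" "h = act k ` base \<or> h = forms - act k ` base" using assms by (auto simp: walls_def)
  have sub: "act k ` base \<subseteq> forms" using act_closed[OF k(1)] base_subset by blast
  have "act g ` act k ` base = act (g \<otimes>\<^bsub>raag G\<^esub> k) ` base" using act_image_mult[OF assms(1) k(1) base_subset] by simp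
  then have "act g ` h = act (g \<otimes>\<^bsub>raag G\<^esub> k) ` base \<or> act g ` h = forms - act (g \<otimes>\<^bsub>raag G\<^esub> k) ` base"
    using k(2) act_image_compl[OF assms(1) sub] by auto
  moreover have "g \<otimes>\<^bsub>raag G\<^esub> k \<in> carrier (raag G)" using assms(1) k(1) by simp
  ultimately show ?thesis unfolding walls_def by blast
qed

text \<open>If \<open>act g []\<close> were nonempty, it would be a prefix of \<open>[]\<close> or a
  proper prefix of a form of length one, according to its last tag.\<close>

lemma base_stabilizer:
  assumes g: "g \<in> carrier (raag G)" and eq: "act g ` base = base"
  shows "act g [] = []"
proof (rule ccontr)
  assume ne: "act g [] \<noteq> []"
  show False
  proof (cases "fst (last (act g []))")
    case True
    have "[] \<in> act g ` (forms - base)" using act_image_compl[OF g base_subset] eq by (simp add: base_def)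
    then show False using act_true_last[OF g ne True] ne by fastforce
  next
    case False
    obtain s l where l: "[(True, s)] = act g l" "l \<in> base" using base_nonempty eq by blast
    then obtain l' where "[(True, s)] = act g [] @ l'" "l' \<noteq> []" using act_false_last[OF g ne False] by metis
    then show False using ne by (cases "act g []") auto
  qed
qed

text \<open>A conjugate of \<open>x\<close> stabilizes \<open>base\<close>, so it is given by a word
  over \<open>K\<close>. Exponent sums are invariant under conjugation, and a word over a clique
  with vanishing exponent sums is trivial.\<close>

lemma wall_stabilizer_trivial:
  assumes x: "x \<in> carrier (raag G)" and h: "h \<in> walls" and eq: "act x ` h = h"
    and exp: "\<forall>v\<in>K. exponent v x = 0"
  shows "x = \<one>\<^bsub>raag G\<^esub>"
proof -
  obtain g where g: "g \<in> carrier (raag G)" "h = act g ` base \<or> h = forms - act g ` base" using h by (auto simp: walls_def)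
  have sub: "act g ` base \<subseteq> forms" using act_closed[OF g(1)] base_subset by blast
  have sub': "act x ` act g ` base \<subseteq> forms" using act_closed[OF x] sub by blast
  have eq': "act x ` act g ` base = act g ` base"
    using g(2) eq act_image_compl[OF x sub] double_diff[OF sub subset_refl] double_diff[OF sub' subset_refl] by metis
  let ?y = "inv\<^bsub>raag G\<^esub> g \<otimes>\<^bsub>raag G\<^esub> (x \<otimes>\<^bsub>raag G\<^esub> g)"
  have y: "?y \<in> carrier (raag G)" using g x by simp
  have "act ?y ` base = act (inv\<^bsub>raag G\<^esub> g) ` act g ` base"
    using act_image_mult[of "inv\<^bsub>raag G\<^esub> g" "x \<otimes>\<^bsub>raag G\<^esub> g" base] act_image_mult[OF x g(1) base_subset] g x base_subset eq' by simp
  also have "\<dots> = base" using act_image_inv[OF g(1) base_subset] .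
  finally have "act ?y [] = []" by (rule base_stabilizer[OF y])
  then obtain u where u: "u \<in> gwords K" "?y = word_class G u" using act_Nil_clique y by blast
  have "exponent v ?y = exponent v x" for v
    using exponent_conjugate[of "inv\<^bsub>raag G\<^esub> g" x v] g x by (simp add: A.m_assoc)
  then have "?y = \<one>\<^bsub>raag G\<^esub>" using clique_word_eq_one[OF clique u(1)] u(2) exp by simp
  then have "x \<otimes>\<^bsub>raag G\<^esub> g = g" using g x by (metis A.inv_closed A.inv_inv A.inv_solve_left A.m_closed A.r_one A.one_closed)
  then show ?thesis using g x by simp
qed

section \<open>Ping-pong on the two sides of the clique\<close>

lemma act_gen_pow:
  assumes v: "v \<in> verts G - K" and "0 < m" and l: "l \<in> forms" "l = [] \<or> fst (hd l) \<noteq> (v \<in> P)"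
  shows "act (raag_gen G v [^]\<^bsub>raag G\<^esub> (m::nat)) l = (v \<in> P, raag_gen G v [^]\<^bsub>raag G\<^esub> m) # l"
proof -
  have gen: "act (raag_gen G v) k = A.lmul (v \<in> P) (raag_gen G v) k" if "k \<in> forms" for k
    using v that by (simp add: act_class step_def)
  have "act (raag_gen G v [^]\<^bsub>raag G\<^esub> m) k = A.lmul (v \<in> P) (raag_gen G v [^]\<^bsub>raag G\<^esub> m) k" if "k \<in> forms" for m :: nat and k
    using that
  proof (induction m arbitrary: k)
    case 0
    then show ?case by (simp add: act_one) (simp add: A.lmul_def)
  next
    case (Suc m)
    then show ?case using v gen A.lmul_normal_form by (simp add: act_mult A.lmul_mult)
  qed
  then show ?thesis using l raag_gen_pow_neq_one[of v m] assms(1,2) by (simp add: A.lmul_new)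
qed

text \<open>A form outside \<open>base\<close> does not start with the tag of \<open>P\<close>, so
  the power of \<open>p\<close> puts a new entry with that tag in front and moves the form into
  \<open>base\<close>.\<close>

lemma act_P_pow:
  assumes "p \<in> P" "0 < (m::nat)"
  shows "base \<union> act (raag_gen G p [^]\<^bsub>raag G\<^esub> m) ` base = forms"
proof -
  let ?g = "raag_gen G p [^]\<^bsub>raag G\<^esub> m"
  have p: "p \<in> verts G - K" "?g \<in> carrier (raag G)" using assms(1) verts_eq disjoint by auto
  have "act ?g l \<in> base" if "l \<in> forms - base" for l
    using act_gen_pow[OF p(1) assms(2), of l] act_closed[OF p(2), of l] that assms(1) by (auto simp: base_def)
  then have "forms - act ?g ` base \<subseteq> base" unfolding act_image_compl[OF p(2) base_subset, symmetric] by (rule image_subsetI)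
  moreover have "act ?g ` base \<subseteq> forms" using act_closed[OF p(2)] base_subset by auto
  ultimately show ?thesis using base_subset by auto
qed

lemma act_Q_pow:
  assumes "q \<in> Q" "0 < (m::nat)"
  shows "base \<inter> act (raag_gen G q [^]\<^bsub>raag G\<^esub> m) ` base = {}"
proof -
  have q: "q \<in> verts G - K" "q \<notin> P" using assms(1) verts_eq disjoint by auto
  then have "act (raag_gen G q [^]\<^bsub>raag G\<^esub> m) l \<notin> base" if "l \<in> base" for l
    using act_gen_pow[OF q(1) assms(2), of l] that by (auto simp: base_def)
  then show ?thesis by blast
qed

end


section \<open>Commensurable right-angled Artin groups\<close>

lemma (in graph) complete_raag_commute:
  assumes "clique_on G (verts G)" "a \<in> carrier (raag G)" "b \<in> carrier (raag G)"
  shows "a \<otimes>\<^bsub>raag G\<^esub> b = b \<otimes>\<^bsub>raag G\<^esub> a"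
proof -
  obtain u v where uv: "u \<in> gwords (verts G)" "a = word_class G u" "v \<in> gwords (verts G)" "b = word_class G v"
    using assms(2,3) by (elim raag_carrierE)
  then show ?thesis
    using assms(1) raag_words_commute[OF uv(1,3)] gwords_iff[of _ "verts G"] unfolding clique_on_def by blast
qed

theorem corollary3p6:
  fixes \<Gamma> :: "('a, 'b) pre_digraph" and \<Delta> :: "('c, 'd) pre_digraph" and n :: nat
  assumes "graph \<Gamma>" and "graph \<Delta>"
    and "commensurable (raag \<Gamma>) (raag \<Delta>)"
    and "\<forall>k. 0 \<le> k \<and> k \<le> n \<longrightarrow> \<not> has_separating_clique k \<Gamma>"
  shows "\<forall>k. 0 \<le> k \<and> k \<le> n \<longrightarrow> \<not> has_separating_clique k \<Delta>"
proof (intro allI impI notI)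
  fix k assume k: "0 \<le> k \<and> k \<le> n" and sep: "has_separating_clique k \<Delta>"
  interpret \<Gamma>: graph \<Gamma> by fact
  interpret \<Delta>: graph \<Delta> by fact
  interpret A: group "raag \<Gamma>" by (rule group_raag)
  interpret B: group "raag \<Delta>" by (rule group_raag)
  obtain K P where KP: "clique_on \<Delta> K" "card K = k" "P \<noteq> {}" "P \<subset> verts \<Delta> - K"
    "\<forall>v\<in>P. \<forall>w \<in> verts \<Delta> - K. v \<rightarrow>\<^bsub>\<Delta>\<^esub> w \<longrightarrow> w \<in> P"
    using sep unfolding has_separating_clique_iff[OF \<open>graph \<Delta>\<close>] by blast
  define Q where "Q = verts \<Delta> - K - P"
  have K: "K \<subseteq> verts \<Delta>" using KP(1) by (simp add: clique_on_def)
  interpret S: split_graph \<Delta> K P Q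
  proof
    show "verts \<Delta> = K \<union> P \<union> Q" using K KP(4) by (auto simp: Q_def)
  qed (use KP in \<open>auto simp: Q_def\<close>)
  obtain H L \<phi> where H: "finite_index_subgroup H (raag \<Gamma>)" and L: "finite_index_subgroup L (raag \<Delta>)"
    and \<phi>: "\<phi> \<in> iso (raag \<Gamma>\<lparr>carrier := H\<rparr>) (raag \<Delta>\<lparr>carrier := L\<rparr>)"
    using assms(3) by (auto simp: commensurable_def is_iso_def)
  interpret H: subgroup H "raag \<Gamma>" using H by (simp add: finite_index_subgroup_def)
  interpret L: subgroup L "raag \<Delta>" using L by (simp add: finite_index_subgroup_def)
  have \<phi>_mult: "\<phi> (x \<otimes>\<^bsub>raag \<Gamma>\<^esub> y) = \<phi> x \<otimes>\<^bsub>raag \<Delta>\<^esub> \<phi> y" if "x \<in> H" "y \<in> H" for x y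
    using \<phi> that by (simp add: iso_def hom_def)
  have \<phi>_bij: "bij_betw \<phi> H L" using \<phi> by (simp add: iso_def)
  have \<phi>_L: "\<phi> x \<in> L" if "x \<in> H" for x using \<phi>_bij that by (rule bij_betwE[rule_format])
  have \<phi>_carrier: "\<phi> x \<in> carrier (raag \<Delta>)" if "x \<in> H" for x using \<phi>_L[OF that] by (rule L.mem_carrier)
  have \<phi>_one: "\<phi> \<one>\<^bsub>raag \<Gamma>\<^esub> = \<one>\<^bsub>raag \<Delta>\<^esub>"
    using \<phi>_mult[of "\<one>\<^bsub>raag \<Gamma>\<^esub>" "\<one>\<^bsub>raag \<Gamma>\<^esub>"] \<phi>_carrier[of "\<one>\<^bsub>raag \<Gamma>\<^esub>"] by simp
  obtain p q where pq: "p \<in> P" "q \<in> Q" using S.parts_nonempty by blast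
  then have V: "p \<in> verts \<Delta>" "q \<in> verts \<Delta>" "p \<noteq> q" "\<not> p \<rightarrow>\<^bsub>\<Delta>\<^esub> q"
    using S.verts_eq S.disjoint S.no_arc by auto
  \<comment> \<open>One vertex on each side of \<open>K\<close> has a power in \<open>L\<close>;
    pulled back along \<open>\<phi>\<close> these powers become the ping-pong elements
    \<open>a\<close> and \<open>b\<close> of \<open>H\<close>.\<close>
  obtain i j :: nat where i: "0 < i" "raag_gen \<Delta> p [^]\<^bsub>raag \<Delta>\<^esub> i \<in> L" and j: "0 < j" "raag_gen \<Delta> q [^]\<^bsub>raag \<Delta>\<^esub> j \<in> L"
    using B.finite_index_power[OF L, of "raag_gen \<Delta> p"] B.finite_index_power[OF L, of "raag_gen \<Delta> q"] V by auto
  obtain a b where a: "a \<in> H" "\<phi> a = raag_gen \<Delta> p [^]\<^bsub>raag \<Delta>\<^esub> i" and b: "b \<in> H" "\<phi> b = raag_gen \<Delta> q [^]\<^bsub>raag \<Delta>\<^esub> j"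
    using i(2) j(2) unfolding bij_betw_imp_surj_on[OF \<phi>_bij, symmetric] by (elim imageE) simp
  \<comment> \<open>For complete \<open>\<Gamma>\<close> the group is abelian, so \<open>a\<close>
    and \<open>b\<close> commute, whereas positive powers of the nonadjacent \<open>p\<close> and
    \<open>q\<close> do not.\<close>
  have not_complete: "\<not> clique_on \<Gamma> (verts \<Gamma>)"
  proof
    assume "clique_on \<Gamma> (verts \<Gamma>)"
    then have "\<phi> (a \<otimes>\<^bsub>raag \<Gamma>\<^esub> b) = \<phi> (b \<otimes>\<^bsub>raag \<Gamma>\<^esub> a)" using \<Gamma>.complete_raag_commute a(1) b(1) by simp
    then show False
      using \<Delta>.raag_gen_powers_noncommuting[OF V i(1) j(1)] \<phi>_mult a b by simp
  qed
  interpret W: halfspaces S.forms S.walls by (rule S.halfspaces_walls)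
  interpret R: virtual_action "raag \<Gamma>" S.forms S.walls H "\<lambda>z. S.act (\<phi> z)"
  proof
    show "\<exists>m>0. x [^]\<^bsub>raag \<Gamma>\<^esub> (m::nat) \<in> H" if "x \<in> carrier (raag \<Gamma>)" for x
      using A.finite_index_power[OF H that] .
    show "S.act (\<phi> (y \<otimes>\<^bsub>raag \<Gamma>\<^esub> z)) l = S.act (\<phi> y) (S.act (\<phi> z) l)" if "y \<in> H" "z \<in> H" "l \<in> S.forms" for y z l
      using that S.act_mult[OF \<phi>_carrier \<phi>_carrier] \<phi>_mult by simp
    show "S.act (\<phi> z) ` h \<in> S.walls" if "z \<in> H" "h \<in> S.walls" for z h
      using that S.walls_act[OF \<phi>_carrier] by simp
    show "S.act (\<phi> z) l \<in> S.forms" if "z \<in> H" "l \<in> S.forms" for z l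
      using that S.act_closed[OF \<phi>_carrier] by simp
    show "S.act (\<phi> \<one>\<^bsub>raag \<Gamma>\<^esub>) l = l" if "l \<in> S.forms" for l
      using that S.act_one \<phi>_one by simp
  qed
  \<comment> \<open>The role of \<open>\<epsilon>\<close> is played by the exponent sums of the
    vertices of \<open>K\<close> in \<open>raag \<Delta>\<close>, pulled back along
    \<open>\<phi>\<close>.\<close>
  interpret R: raag_virtual_action "raag \<Gamma>" S.forms S.walls H "\<lambda>z. S.act (\<phi> z)" \<Gamma> "raag_gen \<Gamma>" exponent n
    K "\<lambda>v z. exponent v (\<phi> z)"
  proof
    show "raag_gen \<Gamma> v \<in> carrier (raag \<Gamma>)" if "v \<in> verts \<Gamma>" for v using that by simp
    show "raag_gen \<Gamma> u \<otimes>\<^bsub>raag \<Gamma>\<^esub> raag_gen \<Gamma> v = raag_gen \<Gamma> v \<otimes>\<^bsub>raag \<Gamma>\<^esub> raag_gen \<Gamma> u" if "u \<rightarrow>\<^bsub>\<Gamma>\<^esub> v" for u v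
      using that by (rule \<Gamma>.raag_gen_commute)
    show "raag_gen \<Gamma> u [^]\<^bsub>raag \<Gamma>\<^esub> (i::nat) \<otimes>\<^bsub>raag \<Gamma>\<^esub> raag_gen \<Gamma> v [^]\<^bsub>raag \<Gamma>\<^esub> (j::nat) \<noteq>
      raag_gen \<Gamma> v [^]\<^bsub>raag \<Gamma>\<^esub> j \<otimes>\<^bsub>raag \<Gamma>\<^esub> raag_gen \<Gamma> u [^]\<^bsub>raag \<Gamma>\<^esub> i"
      if "u \<in> verts \<Gamma>" "v \<in> verts \<Gamma>" "u \<noteq> v" "\<not> u \<rightarrow>\<^bsub>\<Gamma>\<^esub> v" "0 < i" "0 < j" for u v i j
      using that by (rule \<Gamma>.raag_gen_powers_noncommuting)
    show "exponent v (x \<otimes>\<^bsub>raag \<Gamma>\<^esub> y) = exponent v x + exponent v y"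
      if "x \<in> carrier (raag \<Gamma>)" "y \<in> carrier (raag \<Gamma>)" for v x y using that by (rule \<Gamma>.exponent_mult)
    show "exponent v (raag_gen \<Gamma> u) = (if u = v then 1 else 0)" if "u \<in> verts \<Gamma>" for u v
      using that by (rule \<Gamma>.exponent_gen)
    show "F g = F \<one>\<^bsub>raag \<Gamma>\<^esub>" if "\<And>g v. g \<in> carrier (raag \<Gamma>) \<Longrightarrow> v \<in> verts \<Gamma> \<Longrightarrow> F (g \<otimes>\<^bsub>raag \<Gamma>\<^esub> raag_gen \<Gamma> v) = F g"
      "g \<in> carrier (raag \<Gamma>)" for F :: "_ \<Rightarrow> bool" and g
      using that by (rule \<Gamma>.raag_gen_invariant)
    show "\<not> has_separating_clique l \<Gamma>" if "l \<le> n" for l using that assms(4) by simp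
    show "\<not> clique_on \<Gamma> (verts \<Gamma>)" by (rule not_complete)
    show "finite K" using K \<Delta>.finite_verts by (rule finite_subset)
    show "card K \<le> n" using KP(2) k by simp
    show "exponent v (\<phi> (x \<otimes>\<^bsub>raag \<Gamma>\<^esub> y)) = exponent v (\<phi> x) + exponent v (\<phi> y)" if "x \<in> H" "y \<in> H" for v x y
      using that \<phi>_mult \<Delta>.exponent_mult[OF \<phi>_carrier \<phi>_carrier] by simp
    fix x h assume x: "x \<in> H" and h: "h \<in> S.walls" "R.translate x h = h" and exp: "\<forall>v\<in>K. exponent v (\<phi> x) = 0"
    have "\<phi> x = \<one>\<^bsub>raag \<Delta>\<^esub>"
      using S.wall_stabilizer_trivial[OF \<phi>_carrier[OF x] h(1) _ exp] h(2) by (simp add: R.translate_def)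
    then show "x = \<one>\<^bsub>raag \<Gamma>\<^esub>"
      using \<phi>_bij x \<phi>_one H.one_closed unfolding bij_betw_def inj_on_def by metis
  qed
  have base: "S.base \<in> S.walls"
    unfolding S.walls_def using S.act_image_one[OF S.base_subset] B.one_closed by blast
  \<comment> \<open>The power of \<open>q\<close> moves \<open>S.base\<close> off itself, and the
    power of \<open>p\<close> does the same to its complement.\<close>
  have "S.base \<inter> R.translate b S.base = {}" "S.base \<union> R.translate a S.base = S.forms"
    using S.act_Q_pow[OF pq(2) j(1)] S.act_P_pow[OF pq(1) i(1)] a b by (simp_all add: R.translate_def)
  then show False using R.no_ping_pong[OF base b(1) _ a(1)] by blast
qed

end
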